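(* Let $T$ be a self-similar tree without dead ends. Then the set $\mathcal{R}_T$ of rational homeomorphisms of $\partial T$ forms a group under composition. Moreover, the action of $\mathcal{R}_T$ on $\partial T$ is rational: there exist a continuous surjection $q\colon\{0,1\}^\omega\to\partial T$ and an injective homomorphism $\varphi\colon\mathcal{R}_T\to\mathcal{R}_2$ with $q\circ\varphi(f)=f\circ q$ for all $f\in\mathcal{R}_T$. In particular, $\mathcal{R}_T$ embeds in $\mathcal{R}_2$.
   Context: A self-similar tree is a locally finite rooted tree $T$ with a partition of the vertices into finitely many types, together with, for every pair $u,v$ of vertices of the same type, a nonempty finite set $\mathrm{Mor}(u,v)$ of type-preserving rooted tree isomorphisms $T_u\to T_v$, called morphisms; here $T_v$ is the subtree of $v$ and its descendants. Morphisms are required to be closed under inverses, under composition, and under restriction to subtrees $T_u$, $u\in T_v$ (the restriction lying in $\mathrm{Mor}(u,\varphi(u))$). $T$ is without dead ends if every vertex has at least one child. $\partial T$ is the space of infinite descending paths from the root, with basic open sets $\partial T_v$. A morphism $\varphi$ induces a homeomorphism $\varphi_*$ between boundaries of subtrees. A homeomorphism $f\colon\partial T\to\partial T'$ has equivalent restrictions at same-type vertices $v,w$ of $T$ if there exist same-type vertices $x,y$ of $T'$ and morphisms $\varphi\in\mathrm{Mor}(v,w)$, $\psi\in\mathrm{Mor}(x,y)$ with $f(\partial T_v)\subseteq\partial T'_x$, $f(\partial T_w)\subseteq\partial T'_y$ and $f\circ\varphi_*=\psi_*\circ f$ on $\partial T_v$. This is an equivalence relation, and $f$ is rational if there are finitely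 many equivalence classes. $\mathcal{R}_2$ is the group of homeomorphisms of $\{0,1\}^\omega$ computed by nondegenerate asynchronous finite-state transducers, i.e., those that output a finite, possibly empty, binary word for each input letter read, and whose total output is infinite on every infinite input. *)

theory Defs
  imports "HOL-Analysis.Analysis" "HOL-Algebra.Group"
begin

text \<open>A rooted locally finite tree is encoded (up to isomorphism) as a prefix-closed set of
  finite words over nat; the root is the empty word and the children of v are the words v @ [i].\<close>

definition rooted_lf_tree :: "nat list set \<Rightarrow> bool" where
  "rooted_lf_tree T \<longleftrightarrow> [] \<in> T \<and> (\<forall>v i. v @ [i] \<in> T \<longrightarrow> v \<in> T)
     \<and> (\<forall>v\<in>T. finite {i. v @ [i] \<in> T})"

definition no_dead_ends :: "nat list set \<Rightarrow> bool" where
  "no_dead_ends T \<longleftrightarrow> (\<forall>v\<in>T. \<exists>i. v @ [i] \<in> T)"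

definition subtree :: "nat list set \<Rightarrow> nat list \<Rightarrow> nat list set" where
  "subtree T u = {x \<in> T. \<exists>z. x = u @ z}"

definition is_morph ::
  "nat list set \<Rightarrow> (nat list \<Rightarrow> 'k) \<Rightarrow> nat list \<Rightarrow> nat list \<Rightarrow> (nat list \<Rightarrow> nat list) \<Rightarrow> bool" where
  "is_morph T tp u v \<phi> \<longleftrightarrow>
     \<phi> \<in> extensional (subtree T u) \<and>
     bij_betw \<phi> (subtree T u) (subtree T v) \<and>
     \<phi> u = v \<and>
     (\<forall>x\<in>subtree T u. \<forall>y\<in>subtree T u.
        (\<exists>i. y = x @ [i]) \<longleftrightarrow> (\<exists>j. \<phi> y = \<phi> x @ [j])) \<and>
     (\<forall>x\<in>subtree T u. tp (\<phi> x) = tp x)"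

definition self_similar ::
  "nat list set \<Rightarrow> (nat list \<Rightarrow> 'k) \<Rightarrow> (nat list \<Rightarrow> nat list \<Rightarrow> (nat list \<Rightarrow> nat list) set) \<Rightarrow> bool" where
  "self_similar T tp Mor \<longleftrightarrow>
     rooted_lf_tree T \<and>
     finite (tp ` T) \<and>
     (\<forall>u\<in>T. \<forall>v\<in>T. tp u = tp v \<longrightarrow>
         Mor u v \<noteq> {} \<and> finite (Mor u v) \<and> (\<forall>\<phi>\<in>Mor u v. is_morph T tp u v \<phi>)) \<and>
     (\<forall>u\<in>T. \<forall>v\<in>T. tp u = tp v \<longrightarrow> (\<forall>\<phi>\<in>Mor u v.
         (\<lambda>y\<in>subtree T v. inv_into (subtree T u) \<phi> y) \<in> Mor v u)) \<and>
     (\<forall>u\<in>T. \<forall>v\<in>T. \<forall>w\<in>T. tp u = tp v \<and> tp v = tp w \<longrightarrow>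
         (\<forall>\<phi>\<in>Mor u v. \<forall>\<psi>\<in>Mor v w. compose (subtree T u) \<psi> \<phi> \<in> Mor u w)) \<and>
     (\<forall>v\<in>T. \<forall>w\<in>T. tp v = tp w \<longrightarrow> (\<forall>\<phi>\<in>Mor v w. \<forall>u\<in>subtree T v.
         restrict \<phi> (subtree T u) \<in> Mor u (\<phi> u)))"

text \<open>An infinite descending path from the root is encoded by its sequence of child indices;
  the boundary carries the subspace topology of the product topology on nat \<Rightarrow> nat
  (nat discrete), whose basic open sets are exactly the cylinders \<partial>T_v.\<close>

definition pre :: "(nat \<Rightarrow> 'a) \<Rightarrow> nat \<Rightarrow> 'a list" where
  "pre p n = map p [0..<n]"

definition bdry :: "nat list set \<Rightarrow> (nat \<Rightarrow> nat) set" where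
  "bdry T = {p. \<forall>n. pre p n \<in> T}"

definition cyl :: "nat list set \<Rightarrow> nat list \<Rightarrow> (nat \<Rightarrow> nat) set" where
  "cyl T v = {p \<in> bdry T. pre p (length v) = v}"

text \<open>Homeomorphism \<partial>T_v \<rightarrow> \<partial>T_w induced by a morphism \<phi> : T_v \<rightarrow> T_w.\<close>
definition induced :: "nat list \<Rightarrow> (nat list \<Rightarrow> nat list) \<Rightarrow> (nat \<Rightarrow> nat) \<Rightarrow> (nat \<Rightarrow> nat)" where
  "induced v \<phi> p = (\<lambda>n. \<phi> (pre p (Suc n + length v)) ! n)"

definition equiv_restr ::
  "nat list set \<Rightarrow> (nat list \<Rightarrow> 'k) \<Rightarrow> (nat list \<Rightarrow> nat list \<Rightarrow> (nat list \<Rightarrow> nat list) set)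
    \<Rightarrow> ((nat \<Rightarrow> nat) \<Rightarrow> (nat \<Rightarrow> nat)) \<Rightarrow> nat list \<Rightarrow> nat list \<Rightarrow> bool" where
  "equiv_restr T tp Mor f v w \<longleftrightarrow> v \<in> T \<and> w \<in> T \<and> tp v = tp w \<and>
     (\<exists>x\<in>T. \<exists>y\<in>T. tp x = tp y \<and>
        (\<exists>\<phi>\<in>Mor v w. \<exists>\<psi>\<in>Mor x y.
           f ` cyl T v \<subseteq> cyl T x \<and> f ` cyl T w \<subseteq> cyl T y \<and>
           (\<forall>p\<in>cyl T v. f (induced v \<phi> p) = induced x \<psi> (f p))))"

definition rational ::
  "nat list set \<Rightarrow> (nat list \<Rightarrow> 'k) \<Rightarrow> (nat list \<Rightarrow> nat list \<Rightarrow> (nat list \<Rightarrow> nat list) set)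
    \<Rightarrow> ((nat \<Rightarrow> nat) \<Rightarrow> (nat \<Rightarrow> nat)) \<Rightarrow> bool" where
  "rational T tp Mor f \<longleftrightarrow> finite (T // {(v, w). equiv_restr T tp Mor f v w})"

definition RT_set ::
  "nat list set \<Rightarrow> (nat list \<Rightarrow> 'k) \<Rightarrow> (nat list \<Rightarrow> nat list \<Rightarrow> (nat list \<Rightarrow> nat list) set)
    \<Rightarrow> ((nat \<Rightarrow> nat) \<Rightarrow> (nat \<Rightarrow> nat)) set" where
  "RT_set T tp Mor = {f \<in> extensional (bdry T).
      (\<exists>g. homeomorphism (bdry T) (bdry T) f g) \<and> rational T tp Mor f}"

definition RT_group ::
  "nat list set \<Rightarrow> (nat list \<Rightarrow> 'k) \<Rightarrow> (nat list \<Rightarrow> nat list \<Rightarrow> (nat list \<Rightarrow> nat list) set)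
    \<Rightarrow> ((nat \<Rightarrow> nat) \<Rightarrow> (nat \<Rightarrow> nat)) monoid" where
  "RT_group T tp Mor = \<lparr> carrier = RT_set T tp Mor,
      mult = (\<lambda>f g. compose (bdry T) f g),
      one = (\<lambda>p\<in>bdry T. p) \<rparr>"

fun run_state :: "(nat \<Rightarrow> bool \<Rightarrow> nat) \<Rightarrow> nat \<Rightarrow> (nat \<Rightarrow> bool) \<Rightarrow> nat \<Rightarrow> nat" where
  "run_state \<delta> s0 x 0 = s0"
| "run_state \<delta> s0 x (Suc n) = \<delta> (run_state \<delta> s0 x n) (x n)"

definition out_prefix ::
  "(nat \<Rightarrow> bool \<Rightarrow> nat) \<Rightarrow> (nat \<Rightarrow> bool \<Rightarrow> bool list) \<Rightarrow> nat \<Rightarrow> (nat \<Rightarrow> bool) \<Rightarrow> nat \<Rightarrow> bool list" where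
  "out_prefix \<delta> out s0 x n = concat (map (\<lambda>k. out (run_state \<delta> s0 x k) (x k)) [0..<n])"

definition computed_by_transducer :: "((nat \<Rightarrow> bool) \<Rightarrow> (nat \<Rightarrow> bool)) \<Rightarrow> bool" where
  "computed_by_transducer f \<longleftrightarrow>
     (\<exists>Q s0 \<delta> out. finite Q \<and> s0 \<in> Q \<and> (\<forall>s\<in>Q. \<forall>b. \<delta> s b \<in> Q) \<and>
        \<comment> \<open>nondegenerate: infinite total output on every infinite input\<close>
        (\<forall>x m. \<exists>n. m < length (out_prefix \<delta> out s0 x n)) \<and>
        (\<forall>x n k. k < length (out_prefix \<delta> out s0 x n) \<longrightarrow> f x k = out_prefix \<delta> out s0 x n ! k))"

definition R2_set :: "((nat \<Rightarrow> bool) \<Rightarrow> (nat \<Rightarrow> bool)) set" where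
  "R2_set = {f. (\<exists>g. homeomorphism UNIV UNIV f g) \<and> computed_by_transducer f}"

definition R2_group :: "((nat \<Rightarrow> bool) \<Rightarrow> (nat \<Rightarrow> bool)) monoid" where
  "R2_group = \<lparr> carrier = R2_set, mult = (\<circ>), one = id \<rparr>"

end

theory Submission
  imports Defs
begin

text \<open>Choose a representative vertex for every type, and one morphism from the representative of
  the appropriate type to each child of a representative. Their composites identify T with the
  language of a finite automaton, in such a way that subtrees of equal type are identified
  by a shift, and the remaining morphisms only contribute a finite set of maps for each type. In
  these coordinates f is rational iff, up to prefixes, only finitely many maps occur as the
  restriction of f to a cone (loc_fin). This is clear for composites. For the inverse of f, a
  compactness argument bounds the prefixes that have to be moved between source and target.

  For the action on binary words, encode the choice of a child by a complete prefix code, the empty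
  word at a vertex with one child. An infinite binary word then decodes to a boundary point, and is
  determined by it unless the point is isolated; in that case only finitely many bits are consumed
  and the unconsumed ones parametrise the fibre. Homeomorphisms preserve isolated points, so f lifts
  to the binary words by keeping the unconsumed bits, and this is functorial. The lift has finitely
  many restrictions to cones up to prefixes, and these are the states of a transducer.\<close>

section \<open>Infinite words\<close>

text \<open>The obstacle behind most of the estimates is a cone with only one point. It has no
  longest common prefix: any initial segment of its point can be split off, so no bound on prefixes
  can hold there. Such cones (\<open>single\<close>) are therefore treated separately in every
  finiteness argument, where one constant map for each type is enough. On any other cone a common
  prefix ends where two points first differ, and since only finitely many types, maps or
  representatives are involved, these bounds become uniform. Coherence is the reason for composing
  chosen morphisms along a path: morphisms chosen independently at all vertices need not restrict to
  one another on subtrees, and then restrictions of f at different vertices could not be compared as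
  maps between the same languages. On the binary side, a boundary with isolated points is not in
  bijection with binary words under decoding, and lifts picked arbitrarily in the fibres need not
  multiply correctly. A second coordinate that f leaves unchanged removes the choice.\<close>

definition conc :: "'a list \<Rightarrow> (nat \<Rightarrow> 'a) \<Rightarrow> nat \<Rightarrow> 'a" where
  "conc v p = (\<lambda>n. if n < length v then v ! n else p (n - length v))"

definition sdrop :: "nat \<Rightarrow> (nat \<Rightarrow> 'a) \<Rightarrow> nat \<Rightarrow> 'a" where
  "sdrop n p = (\<lambda>k. p (n + k))"

lemma length_pre [simp]: "length (pre p n) = n"
  by (simp add: pre_def)

lemma nth_pre [simp]: "i < n \<Longrightarrow> pre p n ! i = p i"
  by (simp add: pre_def)

lemma pre_0 [simp]: "pre p 0 = []"
  by (simp add: pre_def)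

lemma pre_Suc: "pre p (Suc n) = pre p n @ [p n]"
  by (simp add: pre_def)

lemma take_pre: "take m (pre p n) = pre p (min m n)"
  by (rule nth_equalityI) auto

lemma pre_eq_iff: "pre p n = pre q n \<longleftrightarrow> (\<forall>i<n. p i = q i)"
  by (auto simp: list_eq_iff_nth_eq)

lemma pre_eq_mono: "pre p n = pre q n \<Longrightarrow> m \<le> n \<Longrightarrow> pre p m = pre q m"
  by (simp add: pre_eq_iff)

lemma pre_eqD: "pre p n = pre q n \<Longrightarrow> i < n \<Longrightarrow> p i = q i"
  by (simp add: pre_eq_iff)

lemma ext_pre: "(\<And>n. pre p n = pre q n) \<Longrightarrow> p = q"
  by (rule ext) (metis lessI pre_eqD)

lemma conc_Nil [simp]: "conc [] p = p"
  by (simp add: conc_def)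

lemma conc_append: "conc (u @ v) p = conc u (conc v p)"
  by (rule ext) (auto simp: conc_def nth_append)

lemma pre_conc_add: "pre (conc v p) (length v + n) = v @ pre p n"
  by (rule nth_equalityI) (auto simp: conc_def nth_append)

lemma pre_conc_length [simp]: "pre (conc v p) (length v) = v"
  using pre_conc_add[of v p 0] by simp

lemma pre_conc_le: "n \<le> length v \<Longrightarrow> pre (conc v p) n = take n v"
  by (rule nth_equalityI) (auto simp: conc_def)

lemma sdrop_0 [simp]: "sdrop 0 p = p"
  by (simp add: sdrop_def)

lemma sdrop_conc [simp]: "sdrop (length v) (conc v p) = p"
  by (simp add: sdrop_def conc_def)

lemma conc_pre_sdrop [simp]: "conc (pre p n) (sdrop n p) = p"
  by (rule ext) (auto simp: conc_def sdrop_def)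

lemma sdrop_conc_add: "sdrop (length u + n) (conc u p) = sdrop n p"
  by (rule ext) (auto simp: conc_def sdrop_def)

lemma conc_inject [simp]: "conc v p = conc v q \<longleftrightarrow> p = q"
  by (metis sdrop_conc)

text \<open>Used to compare prefixes that come from independent choices but start the same infinite
  word.\<close>

lemma conc_eqD:
  assumes "conc u p = conc v q" "length u \<le> length v"
  obtains z where "v = u @ z" "p = conc z q"
proof -
  have "u = take (length u) v"
    using pre_conc_length[of u p] pre_conc_le[OF assms(2), of q] assms(1) by simp
  then have v: "v = u @ drop (length u) v"
    by (metis append_take_drop_id)
  then have "conc u p = conc u (conc (drop (length u) v) q)"
    using assms(1) by (metis conc_append)
  then show thesis using that v by simp
qed

lemma pre_eq_conc: "pre p (length v) = v \<Longrightarrow> p = conc v (sdrop (length v) p)"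
  by (metis conc_pre_sdrop)

lemma conc_Cons_0 [simp]: "conc (i # v) p 0 = i"
  by (simp add: conc_def)

lemma conc_Cons_Suc [simp]: "conc (i # v) p (Suc n) = conc v p n"
  by (simp add: conc_def)

lemma conc_Cons: "conc (i # v) p = conc [i] (conc v p)"
  using conc_append[of "[i]" v p] by simp

lemma pre_conc_Cons: "pre (conc [i] p) (Suc n) = i # pre p n"
  using pre_conc_add[of "[i]" p n] by simp

lemma pre_add: "pre p (m + n) = pre p m @ pre (sdrop m p) n"
  by (metis conc_pre_sdrop length_pre pre_conc_add)

lemma pre_Suc_Cons: "pre p (Suc n) = p 0 # pre (sdrop 1 p) n"
  using pre_add[of p 1 n] by (simp add: pre_Suc)

lemma open_pre:
  fixes p :: "nat \<Rightarrow> 'a::discrete_topology"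
  shows "open {p'. pre p' n = pre p n}"
proof -
  have "{p'. pre p' n = pre p n} = (\<Inter>i\<in>{..<n}. (\<lambda>p'. p' i) -` {p i})"
    by (auto simp: pre_eq_iff)
  moreover have "open ((\<lambda>p'. p' i) -` {p i})" for i
    by (intro open_vimage open_discrete continuous_on_product_coordinates)
  ultimately show ?thesis by auto
qed

text \<open>Prefix cylinders form a basis of the product topology over a discrete space, so
  continuity can be handled as a statement about finite prefixes.\<close>

lemma continuous_on_pre_iff:
  fixes f :: "(nat \<Rightarrow> 'a::discrete_topology) \<Rightarrow> nat \<Rightarrow> 'b::discrete_topology"
  shows "continuous_on X f \<longleftrightarrow>
    (\<forall>p\<in>X. \<forall>n. \<exists>m. \<forall>p'\<in>X. pre p' m = pre p m \<longrightarrow> pre (f p') n = pre (f p) n)"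
proof
  assume c: "continuous_on X f"
  show "\<forall>p\<in>X. \<forall>n. \<exists>m. \<forall>p'\<in>X. pre p' m = pre p m \<longrightarrow> pre (f p') n = pre (f p) n"
  proof (intro ballI allI)
    fix p n assume p: "p \<in> X"
    have "open {y. pre y n = pre (f p) n}" by (rule open_pre)
    then obtain A where A: "open A" "A \<inter> X = f -` {y. pre y n = pre (f p) n} \<inter> X"
      using c unfolding continuous_on_open_invariant by metis
    have "p \<in> A" using A(2) p by auto
    moreover have "openin (product_topology (\<lambda>i. euclidean) UNIV) A"
      using A(1) by (simp add: open_fun_def)
    ultimately obtain U where U: "p \<in> Pi\<^sub>E UNIV U" "finite {i. U i \<noteq> topspace euclidean}"
      "Pi\<^sub>E UNIV U \<subseteq> A"
      using product_topology_open_contains_basis[of "\<lambda>i. euclidean" UNIV A p] by blast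
    \<comment> \<open>A basic open box constrains finitely many coordinates; m lies beyond all of
      them.\<close>
    then obtain m where m: "\<And>i. U i \<noteq> UNIV \<Longrightarrow> i < m"
      using finite_nat_set_iff_bounded by auto
    have "pre (f p') n = pre (f p) n" if "p' \<in> X" "pre p' m = pre p m" for p'
    proof -
      have "p' i \<in> U i" for i
        using U(1) m[of i] pre_eqD[OF that(2), of i] by (cases "U i = UNIV") (auto simp: PiE_iff)
      then show ?thesis using U(3) A(2) that(1) by (auto simp: PiE_iff)
    qed
    then show "\<exists>m. \<forall>p'\<in>X. pre p' m = pre p m \<longrightarrow> pre (f p') n = pre (f p) n" by blast
  qed
next
  assume R: "\<forall>p\<in>X. \<forall>n. \<exists>m. \<forall>p'\<in>X. pre p' m = pre p m \<longrightarrow> pre (f p') n = pre (f p) n"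
  show "continuous_on X f"
  proof (rule continuous_on_coordinatewise_then_product)
    fix i
    show "continuous_on X (\<lambda>x. f x i)"
      unfolding continuous_on_def
    proof
      fix p assume p: "p \<in> X"
      obtain m where m: "\<And>p'. p' \<in> X \<Longrightarrow> pre p' m = pre p m \<Longrightarrow> pre (f p') (Suc i) = pre (f p) (Suc i)"
        using R p by meson
      have "eventually (\<lambda>p'. p' \<in> {p'. pre p' m = pre p m}) (nhds p)"
        by (rule eventually_nhds_in_open[OF open_pre]) simp
      then have "eventually (\<lambda>p'. f p' i = f p i) (at p within X)"
        unfolding eventually_at_filter
        by eventually_elim (use m pre_eqD in blast)
      then show "((\<lambda>x. f x i) \<longlongrightarrow> f p i) (at p within X)"
        by (simp add: tendsto_discrete)
    qed
  qed
qed

lemma continuous_on_preD: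
  fixes f :: "(nat \<Rightarrow> 'a::discrete_topology) \<Rightarrow> nat \<Rightarrow> 'b::discrete_topology"
  assumes "continuous_on X f" "p \<in> X"
  obtains m where "\<And>p'. p' \<in> X \<Longrightarrow> pre p' m = pre p m \<Longrightarrow> pre (f p') n = pre (f p) n"
  using assms unfolding continuous_on_pre_iff by blast

section \<open>Finitely many local actions give a transducer\<close>

definition nonconst :: "((nat \<Rightarrow> 'a) \<Rightarrow> nat \<Rightarrow> 'b) \<Rightarrow> bool" where
  "nonconst G \<longleftrightarrow> (\<exists>x y. G x \<noteq> G y)"

text \<open>The length of the longest prefix shared by all values of G. It has this meaning for
  \<open>nonconst\<close> G; a constant map has no place of disagreement.\<close>

definition lcp_len :: "((nat \<Rightarrow> 'a) \<Rightarrow> nat \<Rightarrow> 'b) \<Rightarrow> nat" where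
  "lcp_len G = (LEAST n. \<exists>x y. G x n \<noteq> G y n)"

text \<open>\<open>undefined\<close> is an arbitrary sample point: by \<open>pre_lcp\<close> every
  point gives the same word.\<close>

definition lcp :: "((nat \<Rightarrow> 'a) \<Rightarrow> nat \<Rightarrow> 'b) \<Rightarrow> 'b list" where
  "lcp G = pre (G undefined) (lcp_len G)"

definition trim :: "((nat \<Rightarrow> 'a) \<Rightarrow> nat \<Rightarrow> 'b) \<Rightarrow> (nat \<Rightarrow> 'a) \<Rightarrow> nat \<Rightarrow> 'b" where
  "trim G = (\<lambda>x. sdrop (lcp_len G) (G x))"

lemma nonconst_ex: "nonconst G \<Longrightarrow> \<exists>n x y. G x n \<noteq> G y n"
  unfolding nonconst_def by (metis ext)

lemma lcp_len_neq:
  assumes "nonconst G" obtains x y where "G x (lcp_len G) \<noteq> G y (lcp_len G)"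
  using LeastI_ex[OF nonconst_ex[OF assms]] unfolding lcp_len_def by blast

lemma lcp_len_eq: "n < lcp_len G \<Longrightarrow> G x n = G y n"
  unfolding lcp_len_def using not_less_Least by blast

lemma length_lcp [simp]: "length (lcp G) = lcp_len G"
  by (simp add: lcp_def)

lemma pre_lcp: "pre (G x) (lcp_len G) = lcp G"
  unfolding lcp_def pre_eq_iff using lcp_len_eq by blast

lemma conc_lcp_trim: "G x = conc (lcp G) (trim G x)"
  unfolding trim_def using pre_lcp[of G x] conc_pre_sdrop by metis

lemma lcp_len_ge:
  assumes "nonconst G" "\<And>x y. pre (G x) n = pre (G y) n"
  shows "n \<le> lcp_len G"
  using assms lcp_len_neq pre_eqD by (metis not_le)

lemma lcp_len_eqI:
  assumes "\<And>x y. pre (G x) n = pre (G y) n" "G x n \<noteq> G y n"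
  shows "lcp_len G = n"
  unfolding lcp_len_def by (rule Least_equality) (use assms pre_eqD in \<open>blast, metis not_le\<close>)

lemma lcp_len_conc:
  assumes "nonconst G" shows "lcp_len (\<lambda>x. conc w (G x)) = length w + lcp_len G"
proof -
  obtain x y where "G x (lcp_len G) \<noteq> G y (lcp_len G)" using lcp_len_neq[OF assms] by blast
  then show ?thesis
    by (intro lcp_len_eqI[where x=x and y=y]) (auto simp: pre_conc_add pre_lcp, simp add: conc_def)
qed

lemma nonconst_conc [simp]: "nonconst (\<lambda>x. conc w (G x)) \<longleftrightarrow> nonconst G"
  by (simp add: nonconst_def)

text \<open>This is what makes trimmed maps suitable as states: restrictions that differ by a prefix
  have the same trim.\<close>

lemma trim_conc: "nonconst G \<Longrightarrow> trim (\<lambda>x. conc w (G x)) = trim G"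
  unfolding trim_def by (simp add: lcp_len_conc sdrop_conc_add)

lemma nonconst_trim [simp]: "nonconst (trim G) \<longleftrightarrow> nonconst G"
  using conc_lcp_trim[of G] unfolding nonconst_def by (metis conc_inject)

lemma lcp_len_trim: "nonconst G \<Longrightarrow> lcp_len (trim G) = 0"
  using lcp_len_conc[of "trim G" "lcp G"] by (simp flip: conc_lcp_trim)

lemma trim_trim: "nonconst G \<Longrightarrow> trim (trim G) = trim G"
  by (rule ext) (simp add: trim_def[of "trim G"] lcp_len_trim)

definition ahead :: "'a \<Rightarrow> ((nat \<Rightarrow> 'a) \<Rightarrow> 'c) \<Rightarrow> (nat \<Rightarrow> 'a) \<Rightarrow> 'c" where
  "ahead b G = (\<lambda>x. G (conc [b] x))"

text \<open>State n of the transducer is the action of F after n letters, with all determined output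
  stripped off; the start state is F itself, so that the first transition also emits the common
  prefix of the whole image.\<close>

fun act :: "((nat \<Rightarrow> 'a) \<Rightarrow> nat \<Rightarrow> 'b) \<Rightarrow> (nat \<Rightarrow> 'a) \<Rightarrow> nat \<Rightarrow> (nat \<Rightarrow> 'a) \<Rightarrow> nat \<Rightarrow> 'b" where
  "act F x 0 = F"
| "act F x (Suc n) = trim (ahead (x n) (act F x n))"

lemma act_spec:
  fixes F :: "(nat \<Rightarrow> 'a) \<Rightarrow> nat \<Rightarrow> 'b" and x :: "nat \<Rightarrow> 'a"
  defines "w \<equiv> \<lambda>n. concat (map (\<lambda>k. lcp (ahead (x k) (act F x k))) [0..<n])"
  shows "F (conc (pre x n) y) = conc (w n) (act F x n y)"
proof (induction n arbitrary: y)
  case 0 then show ?case by (simp add: w_def)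
next
  case (Suc n)
  have "F (conc (pre x (Suc n)) y) = conc (w n) (ahead (x n) (act F x n) y)"
    by (simp add: pre_Suc conc_append Suc.IH ahead_def)
  also have "\<dots> = conc (w n) (conc (lcp (ahead (x n) (act F x n))) (act F x (Suc n) y))"
    using conc_lcp_trim[of "ahead (x n) (act F x n)" y] by simp
  also have "\<dots> = conc (w (Suc n)) (act F x (Suc n) y)"
    by (simp add: w_def conc_append)
  finally show ?case .
qed

text \<open>After the first letter every state is the trimmed restriction of F to a cone, and
  trimming removes the prefix y of \<open>loc\<close>, so these states lie in the image of \<H>
  under \<open>trim\<close>. The output is infinite because, by continuity, values of F on small
  cones share long prefixes, and a trimmed state holds none of them back.\<close>

lemma computed_by_transducerI:
  fixes F :: "(nat \<Rightarrow> bool) \<Rightarrow> nat \<Rightarrow> bool"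
  assumes cont: "continuous_on UNIV F" and inj: "inj F" and fin: "finite \<H>"
    and loc: "\<And>w. \<exists>y. \<exists>H\<in>\<H>. \<forall>x. F (conc w x) = conc y (H x)"
  shows "computed_by_transducer F"
proof -
  have nc: "nonconst (\<lambda>x. F (conc w x))" for w
  proof -
    have "conc w (\<lambda>_. True) \<noteq> conc w (\<lambda>_. False)" by (auto dest: fun_cong)
    then show ?thesis using inj unfolding nonconst_def inj_def by blast
  qed
  have nca: "nonconst (act F x n)" for x n
    using nc[of "pre x n"] by (simp add: act_spec)
  have trim_act: "trim (act F x n) = trim (\<lambda>y. F (conc (pre x n) y))" for x n
    using trim_conc[OF nca] by (simp add: act_spec)
  have act_Suc: "act F x (Suc n) \<in> trim ` \<H>" for x n
  proof -
    have "nonconst (ahead (x n) (act F x n))" using nca[of x "Suc n"] by simp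
    then have "act F x (Suc n) = trim (act F x (Suc n))" by (simp add: trim_trim)
    also have "\<dots> = trim (\<lambda>y. F (conc (pre x (Suc n)) y))" by (rule trim_act)
    finally have e: "act F x (Suc n) = trim (\<lambda>y. F (conc (pre x (Suc n)) y))" .
    obtain y H where H: "H \<in> \<H>" "\<And>z. F (conc (pre x (Suc n)) z) = conc y (H z)"
      using loc by metis
    then have "nonconst H" using nc[of "pre x (Suc n)"] by simp
    then show ?thesis unfolding e H(2) using H(1) by (simp add: trim_conc)
  qed
  define \<Q> where "\<Q> = range (\<lambda>(x, n). act F x n)"
  have "\<Q> \<subseteq> insert F (trim ` \<H>)"
  proof
    fix G assume "G \<in> \<Q>"
    then obtain x n where "G = act F x n" by (auto simp: \<Q>_def)
    then show "G \<in> insert F (trim ` \<H>)" using act_Suc by (cases n) auto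
  qed
  then have finQ: "finite \<Q>" using fin by (meson finite.insertI finite_imageI finite_subset)
  then obtain enc :: "_ \<Rightarrow> nat" and k where enc: "inj_on enc \<Q>"
    using finite_imp_inj_to_nat_seg by metis
  define dec where "dec = inv_into \<Q> enc"
  define \<delta> where "\<delta> s b = enc (trim (ahead b (dec s)))" for s b
  define out where "out s b = lcp (ahead b (dec s))" for s b
  have dec: "dec (enc G) = G" if "G \<in> \<Q>" for G
    unfolding dec_def using enc that by simp
  have actQ: "act F x n \<in> \<Q>" for x n unfolding \<Q>_def by force
  have step: "trim (ahead b G) \<in> \<Q>" if G: "G \<in> \<Q>" for G b
  proof -
    obtain x n where Gx: "G = act F x n" using G by (auto simp: \<Q>_def)
    \<comment> \<open>Closure under transitions: replacing letter n of x by b realises the step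
      without changing the states visited before it.\<close>
    have cong: "act F (x(n := b)) m = act F x m" if "m \<le> n" for m
      using that by (induction m) auto
    have "trim (ahead b G) = act F (x(n := b)) (Suc n)" by (simp add: Gx cong)
    then show ?thesis using actQ by metis
  qed
  have state: "run_state \<delta> (enc F) x n = enc (act F x n)" for x n
    by (induction n) (simp_all add: \<delta>_def dec[OF actQ])
  have outp: "out_prefix \<delta> out (enc F) x n
      = concat (map (\<lambda>k. lcp (ahead (x k) (act F x k))) [0..<n])" for x n
    unfolding out_prefix_def by (simp add: state out_def dec[OF actQ])
  have spec: "F (conc (pre x n) y) = conc (out_prefix \<delta> out (enc F) x n) (act F x n y)" for x n y
    unfolding outp by (rule act_spec)
  show ?thesis
    unfolding computed_by_transducer_def
  proof (rule exI[of _ "enc ` \<Q>"], rule exI[of _ "enc F"], rule exI[of _ \<delta>], rule exI[of _ out],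
      intro conjI allI impI ballI)
    show "finite (enc ` \<Q>)" using finQ by simp
    show "enc F \<in> enc ` \<Q>" using actQ[of _ 0] by simp
    show "\<delta> s b \<in> enc ` \<Q>" if "s \<in> enc ` \<Q>" for s b
      using that step by (auto simp: \<delta>_def dec)
    show "\<exists>n. m < length (out_prefix \<delta> out (enc F) x n)" for x m
    proof -
      obtain n where n: "\<And>x'. pre x' n = pre x n \<Longrightarrow> pre (F x') (Suc m) = pre (F x) (Suc m)"
        using continuous_on_preD[OF cont UNIV_I, of x "Suc m"] by auto
      have pe: "pre (F (conc (pre x (Suc n)) y)) (Suc m) = pre (F x) (Suc m)" for y
        by (rule n) (simp add: pre_conc_le take_pre)
      let ?G = "\<lambda>y. F (conc (pre x (Suc n)) y)"
      have "Suc m \<le> lcp_len ?G"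
        by (rule lcp_len_ge[OF nc]) (simp only: pe)
      also have "lcp_len ?G = length (out_prefix \<delta> out (enc F) x (Suc n)) + lcp_len (act F x (Suc n))"
        unfolding spec by (rule lcp_len_conc[OF nca])
      \<comment> \<open>The index is \<open>Suc n\<close> because only states reached by a
        transition are trimmed; the start state may still hold common output.\<close>
      also have "lcp_len (act F x (Suc n)) = 0"
        using lcp_len_trim[of "ahead (x n) (act F x n)"] nca[of x "Suc n"] by simp
      finally show ?thesis by (intro exI[of _ "Suc n"]) simp
    qed
    show "F x k = out_prefix \<delta> out (enc F) x n ! k"
      if "k < length (out_prefix \<delta> out (enc F) x n)" for x n k
    proof -
      have "F x = conc (out_prefix \<delta> out (enc F) x n) (act F x n (sdrop n x))"
        using spec[of x n "sdrop n x"] by simp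
      then show ?thesis using that by (simp add: conc_def)
    qed
  qed
qed

section \<open>Languages of finite automata\<close>

lemma finite_uniform_bound:
  fixes P :: "'i \<Rightarrow> nat \<Rightarrow> bool"
  assumes "finite I" "\<And>i. i \<in> I \<Longrightarrow> \<exists>m. P i m" "\<And>i m n. P i m \<Longrightarrow> m \<le> n \<Longrightarrow> P i n"
  obtains m where "\<And>i. i \<in> I \<Longrightarrow> P i m"
proof -
  obtain f where f: "\<And>i. i \<in> I \<Longrightarrow> P i (f i)" using assms(2) by metis
  have "P i (Max (f ` I))" if "i \<in> I" for i
    using assms(3)[OF f[OF that], of "Max (f ` I)"] assms(1) that by simp
  then show thesis using that by blast
qed

locale automaton =
  fixes Q :: "'k set" and A :: "'k \<Rightarrow> nat set" and d :: "'k \<Rightarrow> nat \<Rightarrow> 'k"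
  assumes finite_Q: "finite Q"
    and finite_A: "t \<in> Q \<Longrightarrow> finite (A t)"
    and nonempty_A: "t \<in> Q \<Longrightarrow> A t \<noteq> {}"
    and d_closed: "t \<in> Q \<Longrightarrow> i \<in> A t \<Longrightarrow> d t i \<in> Q"
begin

abbreviation dl :: "'k \<Rightarrow> nat list \<Rightarrow> 'k" where
  "dl \<equiv> foldl d"

fun word :: "'k \<Rightarrow> nat list \<Rightarrow> bool" where
  "word t [] = True"
| "word t (i # v) = (i \<in> A t \<and> word (d t i) v)"

definition L :: "'k \<Rightarrow> (nat \<Rightarrow> nat) set" where
  "L t = {p. \<forall>n. word t (pre p n)}"

definition single :: "'k \<Rightarrow> bool" where
  "single t \<longleftrightarrow> (\<exists>p. L t = {p})"

definition isolated :: "'k \<Rightarrow> (nat \<Rightarrow> nat) \<Rightarrow> bool" where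
  "isolated t p \<longleftrightarrow> (\<exists>n. single (dl t (pre p n)))"

text \<open>The prefix x is not normalised to be the longest one, and h matters only on
  \<open>L (dl t v)\<close>. This makes composition easy, but elsewhere the spread of the prefixes
  has to be bounded before finiteness follows.\<close>

definition loc_fin :: "'k \<Rightarrow> ((nat \<Rightarrow> nat) \<Rightarrow> nat \<Rightarrow> nat) \<Rightarrow> bool" where
  "loc_fin t f \<longleftrightarrow> (\<exists>S. finite S \<and> (\<forall>v. word t v \<longrightarrow>
     (\<exists>x. \<exists>h\<in>S. \<forall>p\<in>L (dl t v). f (conc v p) = conc x (h p))))"

lemma word_append [simp]: "word t (u @ v) \<longleftrightarrow> word t u \<and> word (dl t u) v"
  by (induction u arbitrary: t) auto

lemma dl_closed: "t \<in> Q \<Longrightarrow> word t v \<Longrightarrow> dl t v \<in> Q"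
  by (induction v arbitrary: t) (auto simp: d_closed)

lemma word_take: "word t v \<Longrightarrow> word t (take n v)"
  by (metis append_take_drop_id word_append)

lemma word_letters: "t \<in> Q \<Longrightarrow> word t v \<Longrightarrow> set v \<subseteq> \<Union> (A ` Q)"
proof (induction v arbitrary: t)
  case (Cons i v)
  then have "set v \<subseteq> \<Union> (A ` Q)" using d_closed[of t i] by simp
  moreover have "i \<in> \<Union> (A ` Q)" using Cons.prems by auto
  ultimately show ?case by simp
qed simp

lemma finite_words: "finite {z. (\<exists>t\<in>Q. word t z) \<and> length z \<le> n}"
proof (rule finite_subset)
  show "{z. (\<exists>t\<in>Q. word t z) \<and> length z \<le> n} \<subseteq> {z. set z \<subseteq> \<Union> (A ` Q) \<and> length z \<le> n}"
    using word_letters by blast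
  show "finite {z. set z \<subseteq> \<Union> (A ` Q) \<and> length z \<le> n}"
    by (intro finite_lists_length_le) (simp add: finite_Q finite_A)
qed

lemma word_pre: "p \<in> L t \<Longrightarrow> word t (pre p n)"
  by (simp add: L_def)

lemma L_conc [simp]: "conc v p \<in> L t \<longleftrightarrow> word t v \<and> p \<in> L (dl t v)"
proof
  assume a: "conc v p \<in> L t"
  then have "word t (v @ pre p n)" for n
    using word_pre[OF a, of "length v + n"] by (simp add: pre_conc_add)
  then show "word t v \<and> p \<in> L (dl t v)" by (auto simp: L_def)
next
  assume a: "word t v \<and> p \<in> L (dl t v)"
  have "word t (pre (conc v p) n)" for n
  proof (cases "n \<le> length v")
    case True then show ?thesis using a by (simp add: pre_conc_le word_take)
  next
    case False
    then have "pre (conc v p) n = v @ pre p (n - length v)"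
      using pre_conc_add[of v p "n - length v"] by simp
    then show ?thesis using a by (simp add: L_def)
  qed
  then show "conc v p \<in> L t" by (simp add: L_def)
qed

lemma L_sdrop: "p \<in> L t \<Longrightarrow> sdrop n p \<in> L (dl t (pre p n))"
  using L_conc[of "pre p n" "sdrop n p" t] by simp

lemma L_nonempty:
  assumes "t \<in> Q" shows "L t \<noteq> {}"
proof -
  define ch where "ch s = (SOME i. i \<in> A s)" for s
  have ch: "ch s \<in> A s" if "s \<in> Q" for s
    unfolding ch_def using nonempty_A[OF that] by (simp add: some_in_eq)
  define st where "st n = ((\<lambda>s. d s (ch s)) ^^ n) t" for n
  have stQ: "st n \<in> Q" for n
    by (induction n) (simp_all add: st_def assms ch d_closed)
  have "word t (pre (\<lambda>n. ch (st n)) n) \<and> dl t (pre (\<lambda>n. ch (st n)) n) = st n" for n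
    using stQ by (induction n) (simp_all add: pre_Suc ch, simp_all add: st_def)
  then show ?thesis by (auto simp: L_def)
qed

lemma single_L: "single t \<Longrightarrow> p \<in> L t \<Longrightarrow> L t = {p}"
  by (auto simp: single_def)

lemma not_singleE:
  assumes "t \<in> Q" "\<not> single t"
  obtains p p' where "p \<in> L t" "p' \<in> L t" "p \<noteq> p'"
  using assms L_nonempty[OF assms(1)] unfolding single_def by blast

text \<open>The right-hand side is isolation in the topology of \<open>L t\<close>, which is why
  homeomorphisms respect it.\<close>

lemma isolated_iff:
  assumes "p \<in> L t"
  shows "isolated t p \<longleftrightarrow> (\<exists>n. \<forall>p'\<in>L t. pre p' n = pre p n \<longrightarrow> p' = p)"
proof -
  have "single (dl t (pre p n)) \<longleftrightarrow> (\<forall>p'\<in>L t. pre p' n = pre p n \<longrightarrow> p' = p)" for n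
  proof
    assume s: "single (dl t (pre p n))"
    show "\<forall>p'\<in>L t. pre p' n = pre p n \<longrightarrow> p' = p"
    proof (intro ballI impI)
      fix p' assume p': "p' \<in> L t" "pre p' n = pre p n"
      have "L (dl t (pre p n)) = {sdrop n p}" by (rule single_L[OF s L_sdrop[OF assms]])
      moreover have "sdrop n p' \<in> L (dl t (pre p n))" using L_sdrop[OF p'(1), of n] p'(2) by simp
      ultimately have "sdrop n p' = sdrop n p" by simp
      then show "p' = p" using p'(2) by (metis conc_pre_sdrop)
    qed
  next
    assume u: "\<forall>p'\<in>L t. pre p' n = pre p n \<longrightarrow> p' = p"
    have "r = sdrop n p" if "r \<in> L (dl t (pre p n))" for r
    proof -
      have "conc (pre p n) r \<in> L t" using that word_pre[OF assms] by simp
      moreover have "pre (conc (pre p n) r) n = pre p n" using pre_conc_length[of "pre p n" r] by simp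
      ultimately have "conc (pre p n) r = p" using u by blast
      then show ?thesis by (metis length_pre sdrop_conc)
    qed
    then show "single (dl t (pre p n))" using L_sdrop[OF assms, of n] unfolding single_def by blast
  qed
  then show ?thesis by (simp add: isolated_def)
qed

lemma homeo_isolated:
  assumes "homeomorphism (L t) (L t) f g" "p \<in> L t" "isolated t p"
  shows "isolated t (f p)"
proof -
  have fp: "f p \<in> L t" and gf: "g (f p) = p"
    using assms(1,2) by (auto simp: homeomorphism_def)
  obtain n where n: "\<And>p'. p' \<in> L t \<Longrightarrow> pre p' n = pre p n \<Longrightarrow> p' = p"
    using assms(3) isolated_iff[OF assms(2)] by blast
  have "continuous_on (L t) g" using assms(1) by (simp add: homeomorphism_def)
  then obtain m where m: "\<And>q. q \<in> L t \<Longrightarrow> pre q m = pre (f p) m \<Longrightarrow> pre (g q) n = pre (g (f p)) n"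
    using continuous_on_preD[OF _ fp] by metis
  have "q = f p" if "q \<in> L t" "pre q m = pre (f p) m" for q
  proof -
    have "g q \<in> L t" "f (g q) = q" using assms(1) that(1) by (auto simp: homeomorphism_def)
    moreover have "pre (g q) n = pre p n" using m[OF that] gf by simp
    ultimately show ?thesis using n by metis
  qed
  then show ?thesis using isolated_iff[OF fp] by blast
qed

text \<open>Koenig's lemma, applied to the prefixes below which the modulus n fails at every depth.\<close>

lemma uniformly_continuous_L:
  fixes g :: "(nat \<Rightarrow> nat) \<Rightarrow> nat \<Rightarrow> nat"
  assumes t: "t \<in> Q" and c: "continuous_on (L t) g"
  obtains m where "\<And>p p'. p \<in> L t \<Longrightarrow> p' \<in> L t \<Longrightarrow> pre p m = pre p' m \<Longrightarrow> pre (g p) n = pre (g p') n"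
proof -
  define P where "P v m \<longleftrightarrow> (\<exists>p p'. p \<in> L t \<and> p' \<in> L t \<and> pre p (length v) = v \<and> pre p' (length v) = v
      \<and> pre p m = pre p' m \<and> pre (g p) n \<noteq> pre (g p') n)" for v m
  have anti: "P v m" if "P v k" "m \<le> k" for v m k
    using that unfolding P_def by (meson pre_eq_mono)
  have wd: "word t v" if "P v m" for v m
    using that word_pre unfolding P_def by metis
  have step: "\<exists>i. \<forall>m. P (v @ [i]) m" if bad: "\<forall>m. P v m" for v
  proof (rule ccontr)
    assume no: "\<nexists>i. \<forall>m. P (v @ [i]) m"
    have w: "word t v" using bad wd by blast
    have fin: "finite (A (dl t v))" using finite_A dl_closed t w by blast
    obtain m where m: "\<And>i. i \<in> A (dl t v) \<Longrightarrow> \<not> P (v @ [i]) m"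
      using finite_uniform_bound[OF fin, of "\<lambda>i m. \<not> P (v @ [i]) m"] no anti by metis
    \<comment> \<open>Depth at least \<open>Suc (length v)\<close> forces p and p' to share the
      letter after v, so that the failure passes to a child of v.\<close>
    obtain p p' where p: "p \<in> L t" "p' \<in> L t" "pre p (length v) = v" "pre p' (length v) = v"
      "pre p (max m (Suc (length v))) = pre p' (max m (Suc (length v)))" "pre (g p) n \<noteq> pre (g p') n"
      using bad unfolding P_def by meson
    let ?i = "p (length v)"
    have "?i = p' (length v)" by (rule pre_eqD[OF p(5)]) simp
    then have "pre p (Suc (length v)) = v @ [?i]" "pre p' (Suc (length v)) = v @ [?i]"
      using p(3,4) by (simp_all add: pre_Suc)
    moreover have "pre p m = pre p' m" by (rule pre_eq_mono[OF p(5)]) simp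
    ultimately have "P (v @ [?i]) m" unfolding P_def using p by (intro exI[of _ p] exI[of _ p']) simp
    moreover have "?i \<in> A (dl t v)"
      using word_pre[OF p(1), of "Suc (length v)"] p(3) by (simp add: pre_Suc)
    ultimately show False using m by blast
  qed
  show thesis
  proof (cases "\<forall>m. P [] m")
    case False
    then show thesis using that unfolding P_def by (metis list.size(3) pre_0)
  next
    case True
    define nx where "nx v = v @ [SOME i. \<forall>m. P (v @ [i]) m]" for v
    have nx: "\<forall>m. P (nx v) m" if "\<forall>m. P v m" for v
      unfolding nx_def by (rule someI_ex) (rule step[OF that])
    define V where "V k = (nx ^^ k) []" for k
    have bad: "\<forall>m. P (V k) m" for k by (induction k) (simp_all add: V_def True nx)
    define p where "p k = last (V (Suc k))" for k
    have V_Suc: "V (Suc k) = nx (V k)" for k by (simp add: V_def)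
    have "V (Suc k) = V k @ [p k]" for k by (simp add: p_def V_Suc nx_def)
    moreover have "V 0 = []" by (simp add: V_def)
    ultimately have prep: "pre p k = V k" for k by (induction k) (simp_all add: pre_Suc)
    have "word t (pre p k)" for k unfolding prep using bad wd by blast
    then have "p \<in> L t" by (simp add: L_def)
    then obtain m where m: "\<And>q. q \<in> L t \<Longrightarrow> pre q m = pre p m \<Longrightarrow> pre (g q) n = pre (g p) n"
      using continuous_on_preD[OF c] by metis
    \<comment> \<open>Depth 0 suffices: both witnesses extend \<open>pre p m\<close>, and there
      continuity at p already fixes the first n letters of the image.\<close>
    have "P (pre p m) 0" unfolding prep using bad by blast
    then obtain q q' where "q \<in> L t" "q' \<in> L t" "pre q m = pre p m" "pre q' m = pre p m"
      "pre (g q) n \<noteq> pre (g q') n" unfolding P_def by auto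
    then have False using m by simp
    then show thesis ..
  qed
qed

section \<open>Maps with finitely many local actions\<close>

lemma loc_fin_id: "loc_fin t (\<lambda>p. p)"
  unfolding loc_fin_def by (intro exI[of _ "{\<lambda>p. p}"]) auto

lemma loc_fin_cong: "(\<And>p. p \<in> L t \<Longrightarrow> f p = g p) \<Longrightarrow> loc_fin t f \<longleftrightarrow> loc_fin t g"
  unfolding loc_fin_def by simp

text \<open>g sends the cone of v into the cone of its output prefix x, and there f acts by a member
  of its own finite family; hence only products from the two families occur.\<close>

lemma loc_fin_compose:
  assumes t: "t \<in> Q" and f: "loc_fin t f" and g: "loc_fin t g" "g ` L t \<subseteq> L t"
  shows "loc_fin t (\<lambda>p. f (g p))"
proof -
  obtain S where S: "finite S"
    "\<And>v. word t v \<Longrightarrow> \<exists>x. \<exists>h\<in>S. \<forall>p\<in>L (dl t v). f (conc v p) = conc x (h p)"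
    using f unfolding loc_fin_def by blast
  obtain S' where S': "finite S'"
    "\<And>v. word t v \<Longrightarrow> \<exists>x. \<exists>h\<in>S'. \<forall>p\<in>L (dl t v). g (conc v p) = conc x (h p)"
    using g unfolding loc_fin_def by blast
  have "\<exists>y. \<exists>h\<in>(\<lambda>(h, k). h \<circ> k) ` (S \<times> S'). \<forall>p\<in>L (dl t v). f (g (conc v p)) = conc y (h p)"
    if v: "word t v" for v
  proof -
    obtain x k where k: "k \<in> S'" "\<And>p. p \<in> L (dl t v) \<Longrightarrow> g (conc v p) = conc x (k p)"
      using S'(2)[OF v] by blast
    have im: "conc x (k p) \<in> L t" if "p \<in> L (dl t v)" for p
      using k(2)[OF that] g(2) that v by (metis L_conc image_subset_iff)
    have "L (dl t v) \<noteq> {}" using L_nonempty dl_closed t v by blast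
    then have "word t x" using im by auto
    then obtain y h where h: "h \<in> S" "\<And>p. p \<in> L (dl t x) \<Longrightarrow> f (conc x p) = conc y (h p)"
      using S(2) by blast
    have "f (g (conc v p)) = conc y ((h \<circ> k) p)" if "p \<in> L (dl t v)" for p
      using k(2)[OF that] im[OF that] h(2) by simp
    then show ?thesis using h(1) k(1) by blast
  qed
  then show ?thesis unfolding loc_fin_def using S(1) S'(1)
    by (intro exI[of _ "(\<lambda>(h, k). h \<circ> k) ` (S \<times> S')"]) simp
qed

text \<open>An isolated point goes to an isolated point, whose tail beyond some prefix is the only
  element of its language. One constant map per state therefore covers all one-point cones, however
  long the prefixes are.\<close>

lemma loc_fin_single:
  assumes "t \<in> Q" and fg: "homeomorphism (L t) (L t) f g"
  obtains S where "finite S"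
    "\<And>v. word t v \<Longrightarrow> single (dl t v) \<Longrightarrow> \<exists>x. \<exists>h\<in>S. \<forall>p\<in>L (dl t v). f (conc v p) = conc x (h p)"
proof -
  let ?S = "(\<lambda>s _. the_elem (L s)) ` Q"
  have "\<exists>x. \<exists>h\<in>?S. \<forall>p\<in>L (dl t v). f (conc v p) = conc x (h p)"
    if v: "word t v" "single (dl t v)" for v
  proof -
    obtain e where e: "L (dl t v) = {e}" using v(2) by (auto simp: single_def)
    have p: "conc v e \<in> L t" using e v by simp
    moreover have "isolated t (conc v e)" unfolding isolated_def using v(2) by (metis pre_conc_length)
    ultimately obtain n where n: "single (dl t (pre (f (conc v e)) n))"
      using homeo_isolated[OF fg] unfolding isolated_def by blast
    have fp: "f (conc v e) \<in> L t" using fg p by (auto simp: homeomorphism_def)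
    let ?x = "pre (f (conc v e)) n"
    have "L (dl t ?x) = {sdrop n (f (conc v e))}" using single_L[OF n L_sdrop[OF fp]] .
    then have "f (conc v e) = conc ?x (the_elem (L (dl t ?x)))" by simp
    moreover have "dl t ?x \<in> Q" using dl_closed assms(1) word_pre[OF fp] by blast
    ultimately show ?thesis using e
      by (intro exI[of _ ?x] bexI[of _ "\<lambda>_. the_elem (L (dl t ?x))"]) auto
  qed
  moreover have "finite ?S" by (simp add: finite_Q)
  ultimately show thesis using that by blast
qed

text \<open>If x is a prefix whose cone has more than one point, take the longest v with
  g(x L) inside v L and let k be the corresponding action of g, h that of f at v. Then k inverts h
  up to a prefix z which is added or removed. It is bounded in the first case because the inverse
  of h is uniformly continuous while k(x L) branches at its first letter, and in the second case
  because z is a common prefix of a language with more than one element.\<close>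

lemma loc_fin_inverse:
  assumes t: "t \<in> Q" and fg: "homeomorphism (L t) (L t) f g" and f: "loc_fin t f"
  shows "loc_fin t g"
proof -
  have gf: "g (f p) = p" "f (g p) = p" "f p \<in> L t" "g p \<in> L t" if "p \<in> L t" for p
    using fg that by (auto simp: homeomorphism_def)
  have contg: "continuous_on (L t) g" using fg by (simp add: homeomorphism_def)
  have gf': "homeomorphism (L t) (L t) g f" using fg by (rule homeomorphism_symD)
  obtain S where S: "finite S"
    "\<And>v. word t v \<Longrightarrow> \<exists>x. \<exists>h\<in>S. \<forall>p\<in>L (dl t v). f (conc v p) = conc x (h p)"
    using f unfolding loc_fin_def by blast
  obtain S0 where S0: "finite S0"
    "\<And>v. word t v \<Longrightarrow> single (dl t v) \<Longrightarrow> \<exists>x. \<exists>h\<in>S0. \<forall>p\<in>L (dl t v). g (conc v p) = conc x (h p)"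
    using loc_fin_single[OF t gf'] by blast
  define realised where "realised h s \<longleftrightarrow> (\<exists>v x. word t v \<and> dl t v = s \<and> (\<forall>p\<in>L s. f (conc v p) = conc x (h p)))"
    for h :: "(nat \<Rightarrow> nat) \<Rightarrow> nat \<Rightarrow> nat" and s
  \<comment> \<open>B says that the first m letters of h determine the first letter of its argument.
    The guard \<open>realised\<close> makes it vacuous for pairs that never occur, so a bound exists
    for every pair and one K serves all of S \<times> Q.\<close>
  define B where "B hs m \<longleftrightarrow> (realised (fst hs) (snd hs) \<longrightarrow>
      (\<forall>p\<in>L (snd hs). \<forall>p'\<in>L (snd hs). pre (fst hs p) m = pre (fst hs p') m \<longrightarrow> p 0 = p' 0))"
    for hs :: "((nat \<Rightarrow> nat) \<Rightarrow> nat \<Rightarrow> nat) \<times> 'k" and m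
  have exB: "\<exists>m. B hs m" for hs
  proof (cases "realised (fst hs) (snd hs)")
    case False then show ?thesis by (simp add: B_def)
  next
    case True
    obtain h s where hs: "hs = (h, s)" by force
    obtain v x where v: "word t v" "dl t v = s" "\<And>p. p \<in> L s \<Longrightarrow> f (conc v p) = conc x (h p)"
      using True unfolding realised_def hs by auto
    obtain M where M: "\<And>p p'. p \<in> L t \<Longrightarrow> p' \<in> L t \<Longrightarrow> pre p M = pre p' M \<Longrightarrow>
        pre (g p) (Suc (length v)) = pre (g p') (Suc (length v))"
      using uniformly_continuous_L[OF t contg] by blast
    have "p 0 = p' 0" if p: "p \<in> L s" "p' \<in> L s" "pre (h p) M = pre (h p') M" for p p'
    proof -
      have vp: "conc v p \<in> L t" "conc v p' \<in> L t" using v(1,2) p by auto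
      have "pre (conc x (h p)) (length x + M) = pre (conc x (h p')) (length x + M)"
        by (simp add: pre_conc_add p(3))
      then have "pre (f (conc v p)) M = pre (f (conc v p')) M"
        using v(3) p pre_eq_mono le_add2 by metis
      then have "pre (conc v p) (length v + 1) = pre (conc v p') (length v + 1)"
        using M gf vp by (metis Suc_eq_plus1)
      then show ?thesis by (simp add: pre_Suc conc_def)
    qed
    then have "B hs M" unfolding B_def hs fst_conv snd_conv by blast
    then show ?thesis ..
  qed
  obtain K where K: "\<And>hs. hs \<in> S \<times> Q \<Longrightarrow> B hs K"
  proof (rule finite_uniform_bound[of "S \<times> Q" B])
    show "finite (S \<times> Q)" using S(1) finite_Q by simp
    show "B i n" if "B i m" "m \<le> n" for i m n
      using that unfolding B_def by (meson pre_eq_mono)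
  qed (use exB in blast)+
  \<comment> \<open>If two elements of \<open>L s\<close> differ within m letters, no word of length
    at least m is a prefix of all elements.\<close>
  define D where "D s m \<longleftrightarrow> (single s \<or> (\<exists>p\<in>L s. \<exists>p'\<in>L s. pre p m \<noteq> pre p' m))" for s m
  obtain N where N: "\<And>s. s \<in> Q \<Longrightarrow> D s N"
  proof (rule finite_uniform_bound[OF finite_Q, of D])
    show "\<exists>m. D s m" if "s \<in> Q" for s
      using not_singleE[OF that] ext_pre unfolding D_def by metis
    show "D s n" if "D s m" "m \<le> n" for s m n
      using that unfolding D_def by (meson pre_eq_mono)
  qed blast
  define Z where "Z = {z. (\<exists>s\<in>Q. word s z) \<and> length z \<le> K}"
  \<comment> \<open>z is a word to be added in front and n a number of letters to be removed; each
    use below has n = 0 or z = [].\<close>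
  define S' where "S' = (\<lambda>(h, s, z, n). \<lambda>p. inv_into (L s) h (sdrop n (conc z p))) ` (S \<times> Q \<times> Z \<times> {..N})"
  have "finite (S0 \<union> S')"
    unfolding S'_def Z_def using S0(1) S(1) finite_Q finite_words by simp
  moreover have "\<exists>y. \<exists>k\<in>S0 \<union> S'. \<forall>p\<in>L (dl t x). g (conc x p) = conc y (k p)" if x: "word t x" for x
  proof (cases "single (dl t x)")
    case True
    then show ?thesis using S0(2)[OF x] by blast
  next
    case False
    let ?s = "dl t x"
    have sQ: "?s \<in> Q" using dl_closed t x by blast
    have xp: "conc x p \<in> L t" if "p \<in> L ?s" for p using that x by simp
    obtain q q' where q: "q \<in> L ?s" "q' \<in> L ?s" "q \<noteq> q'" using not_singleE[OF sQ False] .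
    have "g (conc x q) \<noteq> g (conc x q')" using q gf(2) xp by (metis conc_inject)
    then have ex: "\<exists>n. \<exists>p\<in>L ?s. \<exists>p'\<in>L ?s. g (conc x p) n \<noteq> g (conc x p') n" using q(1,2) by blast
    \<comment> \<open>The first position where values of g on the cone of x disagree; what precedes
      it is the longest possible v.\<close>
    define l where "l = (LEAST n. \<exists>p\<in>L ?s. \<exists>p'\<in>L ?s. g (conc x p) n \<noteq> g (conc x p') n)"
    obtain p1 p2 where p12: "p1 \<in> L ?s" "p2 \<in> L ?s" "g (conc x p1) l \<noteq> g (conc x p2) l"
      using LeastI_ex[OF ex] unfolding l_def[symmetric] by blast
    define v where "v = pre (g (conc x q)) l"
    define k where "k p = sdrop l (g (conc x p))" for p
    have gk: "g (conc x p) = conc v (k p)" if "p \<in> L ?s" for p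
    proof -
      have "pre (g (conc x p)) l = v"
        unfolding v_def pre_eq_iff l_def using not_less_Least that q(1) by blast
      then show ?thesis unfolding k_def by (metis conc_pre_sdrop)
    qed
    have wv: "word t v" unfolding v_def using gf(4) xp q(1) word_pre by blast
    let ?r = "dl t v"
    have rQ: "?r \<in> Q" using dl_closed t wv by blast
    have kL: "k p \<in> L ?r" if "p \<in> L ?s" for p
      using gf(4)[OF xp[OF that]] gk[OF that] by simp
    obtain y h where h: "h \<in> S" "\<And>p. p \<in> L ?r \<Longrightarrow> f (conc v p) = conc y (h p)"
      using S(2)[OF wv] by blast
    have injh: "inj_on h (L ?r)"
    proof (rule inj_onI)
      fix a b assume ab: "a \<in> L ?r" "b \<in> L ?r" "h a = h b"
      then have "f (conc v a) = f (conc v b)" using h(2) by simp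
      then show "a = b" using ab wv gf(1) by (metis L_conc conc_inject)
    qed
    have xy: "conc x p = conc y (h (k p))" if "p \<in> L ?s" for p
      using gf(2)[OF xp[OF that]] gk[OF that] h(2)[OF kL[OF that]] by simp
    have inv: "k p = inv_into (L ?r) h (h (k p))" if "p \<in> L ?s" for p
      using inv_into_f_f[OF injh kL[OF that]] by simp
    have k0: "k p1 0 \<noteq> k p2 0" using p12 by (simp add: k_def sdrop_def)
    have "\<exists>k'\<in>S'. \<forall>p\<in>L ?s. k p = k' p"
    proof (cases "length y \<le> length x")
      case True
      obtain z where z: "x = y @ z" using conc_eqD[OF xy[OF q(1), symmetric] True] by blast
      have hk: "h (k p) = conc z p" if "p \<in> L ?s" for p
        using xy[OF that] by (simp add: z conc_append)
      have wz: "word t y" "word (dl t y) z" using x z by auto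
      have "length z \<le> K"
      proof (rule ccontr)
        assume "\<not> length z \<le> K"
        then have "pre (h (k p1)) K = pre (h (k p2)) K"
          using p12 by (simp add: hk pre_conc_le)
        moreover have "realised h ?r" unfolding realised_def using wv h(2) by blast
        ultimately show False
          using K[of "(h, ?r)"] h(1) rQ k0 kL p12 unfolding B_def by auto
      qed
      then have "z \<in> Z" unfolding Z_def using wz dl_closed t by blast
      then have mem: "(\<lambda>p. inv_into (L ?r) h (sdrop 0 (conc z p))) \<in> S'"
        unfolding S'_def using h(1) rQ by (intro image_eqI[of _ _ "(h, ?r, z, 0)"]) auto
      have eq: "k p = inv_into (L ?r) h (sdrop 0 (conc z p))" if "p \<in> L ?s" for p
        using inv[OF that] hk[OF that] by simp
      show ?thesis by (intro bexI[OF _ mem] ballI) (rule eq)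
    next
      case False
      obtain z where z: "y = x @ z" using conc_eqD[OF xy[OF q(1)]] False by (metis nat_le_linear)
      have pz: "p = conc z (h (k p))" if "p \<in> L ?s" for p
        using xy[OF that] by (simp add: z conc_append)
      have hk: "h (k p) = sdrop (length z) (conc [] p)" if "p \<in> L ?s" for p
        using pz[OF that] sdrop_conc[of z "h (k p)"] by simp
      have "length z \<le> N"
      proof (rule ccontr)
        assume n: "\<not> length z \<le> N"
        have "pre p N = take N z" if "p \<in> L ?s" for p
          using pz[OF that] pre_conc_le[of N z "h (k p)"] n by simp
        then show False using N[OF sQ] \<open>\<not> single ?s\<close> unfolding D_def by metis
      qed
      moreover have "[] \<in> Z" unfolding Z_def using t by auto
      ultimately have mem: "(\<lambda>p. inv_into (L ?r) h (sdrop (length z) (conc [] p))) \<in> S'"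
        unfolding S'_def using h(1) rQ by (intro image_eqI[of _ _ "(h, ?r, [], length z)"]) auto
      have eq: "k p = inv_into (L ?r) h (sdrop (length z) (conc [] p))" if "p \<in> L ?s" for p
        using inv[OF that] hk[OF that] by simp
      show ?thesis by (intro bexI[OF _ mem] ballI) (rule eq)
    qed
    then obtain k' where "k' \<in> S'" "\<forall>p\<in>L ?s. k p = k' p" by blast
    then show ?thesis using gk by (intro exI[of _ v] bexI[of _ k']) auto
  qed
  ultimately show ?thesis unfolding loc_fin_def by blast
qed

end

section \<open>Binary coding\<close>

text \<open>Completeness means that decoding neither fails nor has a choice. The second clause ties
  reading to branching: bits are consumed exactly where there are several children.\<close>

definition prefix_code :: "'a set \<Rightarrow> ('a \<Rightarrow> bool list) \<Rightarrow> bool" where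
  "prefix_code B c \<longleftrightarrow> (\<forall>x. \<exists>!i. i \<in> B \<and> pre x (length (c i)) = c i) \<and> (\<forall>i\<in>B. c i = [] \<longleftrightarrow> card B = 1)"

text \<open>The unary code: a new letter gets \<open>[False]\<close>, and True is put in front of
  all older code words. The induction starts with the empty word for a single letter.\<close>

lemma prefix_code_exists:
  assumes "finite B" "B \<noteq> {}"
  shows "\<exists>c. prefix_code B c"
  using assms
proof (induction B rule: finite_ne_induct)
  case (singleton i)
  show ?case by (intro exI[of _ "\<lambda>_. []"]) (auto simp: prefix_code_def)
next
  case (insert i B)
  then obtain c where c: "prefix_code B c" by blast
  define c' where "c' j = (if j = i then [False] else True # c j)" for j
  have "\<exists>!j. j \<in> insert i B \<and> pre x (length (c' j)) = c' j" for x
  proof (cases "x 0")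
    case True
    have "(j \<in> insert i B \<and> pre x (length (c' j)) = c' j) \<longleftrightarrow>
        (j \<in> B \<and> pre (sdrop 1 x) (length (c j)) = c j)" for j
      using True insert.hyps by (auto simp: c'_def pre_Suc_Cons)
    then show ?thesis using c by (simp add: prefix_code_def)
  next
    case False
    have "(j \<in> insert i B \<and> pre x (length (c' j)) = c' j) \<longleftrightarrow> j = i" for j
      using False by (auto simp: c'_def pre_Suc_Cons)
    then show ?thesis by simp
  qed
  moreover have "card (insert i B) \<noteq> 1"
    using insert.hyps by (simp add: card_eq_0_iff)
  moreover have "c' j \<noteq> []" for j by (simp add: c'_def)
  ultimately show ?case unfolding prefix_code_def by blast
qed

context automaton
begin

definition code :: "'k \<Rightarrow> nat \<Rightarrow> bool list" where
  "code t = (SOME c. prefix_code (A t) c)"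

definition decode :: "'k \<Rightarrow> (nat \<Rightarrow> bool) \<Rightarrow> nat" where
  "decode t x = (THE i. i \<in> A t \<and> pre x (length (code t i)) = code t i)"

fun iter :: "nat \<Rightarrow> 'k \<Rightarrow> (nat \<Rightarrow> bool) \<Rightarrow> 'k \<times> (nat \<Rightarrow> bool)" where
  "iter 0 t x = (t, x)"
| "iter (Suc n) t x = iter n (d t (decode t x)) (sdrop (length (code t (decode t x))) x)"

text \<open>E is the decoder, producing the path letter by letter; \<open>res t x n\<close> consists
  of the bits still unread after n letters.\<close>

definition E :: "'k \<Rightarrow> (nat \<Rightarrow> bool) \<Rightarrow> nat \<Rightarrow> nat" where
  "E t x n = (case iter n t x of (s, y) \<Rightarrow> decode s y)"

definition res :: "'k \<Rightarrow> (nat \<Rightarrow> bool) \<Rightarrow> nat \<Rightarrow> nat \<Rightarrow> bool" where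
  "res t x n = snd (iter n t x)"

text \<open>If x decodes to an isolated point, then decoding consumes only finitely many bits, and the
  others are left over. They are the coordinate of x in the fibre.\<close>

definition left :: "'k \<Rightarrow> (nat \<Rightarrow> bool) \<Rightarrow> nat \<Rightarrow> bool" where
  "left t x = (if isolated t (E t x) then res t x (LEAST n. single (dl t (pre (E t x) n))) else (\<lambda>_. False))"

fun encode :: "'k \<Rightarrow> nat list \<Rightarrow> bool list" where
  "encode t [] = []"
| "encode t (i # v) = code t i @ encode (d t i) v"

lemma encode_append: "encode t (u @ v) = encode t u @ encode (dl t u) v"
  by (induction u arbitrary: t) auto

lemma prefix_code: "t \<in> Q \<Longrightarrow> prefix_code (A t) (code t)"
  unfolding code_def using someI_ex[OF prefix_code_exists[OF finite_A nonempty_A]] .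

lemma code_ex1: "t \<in> Q \<Longrightarrow> \<exists>!i. i \<in> A t \<and> pre x (length (code t i)) = code t i"
  using prefix_code unfolding prefix_code_def by blast

lemma code_Nil_iff: "t \<in> Q \<Longrightarrow> i \<in> A t \<Longrightarrow> code t i = [] \<longleftrightarrow> card (A t) = 1"
  using prefix_code unfolding prefix_code_def by blast

lemma decode_in: "t \<in> Q \<Longrightarrow> decode t x \<in> A t"
  and decode_pre: "t \<in> Q \<Longrightarrow> pre x (length (code t (decode t x))) = code t (decode t x)"
  using theI'[OF code_ex1] unfolding decode_def by blast+

lemma decode_conc: "t \<in> Q \<Longrightarrow> i \<in> A t \<Longrightarrow> decode t (conc (code t i) y) = i"
  unfolding decode_def by (rule the1_equality[OF code_ex1]) auto

lemma E_conc: "E t x = conc [decode t x] (E (d t (decode t x)) (sdrop (length (code t (decode t x))) x))"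
proof
  show "E t x n = conc [decode t x] (E (d t (decode t x)) (sdrop (length (code t (decode t x))) x)) n" for n
    by (cases n) (simp_all add: E_def)
qed

lemma iter_add: "iter (m + n) t x = (case iter m t x of (s, y) \<Rightarrow> iter n s y)"
  by (induction m arbitrary: t x) auto

lemma iter_encode: "t \<in> Q \<Longrightarrow> word t v \<Longrightarrow> iter (length v) t (conc (encode t v) y) = (dl t v, y)"
  by (induction v arbitrary: t) (auto simp: conc_append decode_conc d_closed)

lemma E_encode: "t \<in> Q \<Longrightarrow> word t v \<Longrightarrow> E t (conc (encode t v) y) = conc v (E (dl t v) y)"
proof (induction v arbitrary: t)
  case (Cons i v)
  then have "E t (conc (encode t (i # v)) y) = conc [i] (E (d t i) (conc (encode (d t i) v) y))"
    using E_conc[of t "conc (encode t (i # v)) y"] by (simp add: conc_append decode_conc)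
  also have "\<dots> = conc [i] (conc v (E (dl (d t i) v) y))"
    using Cons by (simp add: d_closed)
  finally show ?case by (simp add: conc_Cons[of i v])
qed simp

lemma iter_spec:
  assumes "t \<in> Q"
  shows "word t (pre (E t x) n) \<and> iter n t x = (dl t (pre (E t x) n), res t x n) \<and>
    x = conc (encode t (pre (E t x) n)) (res t x n)"
  using assms
proof (induction n arbitrary: t x)
  case 0 then show ?case by (simp add: res_def)
next
  case (Suc n)
  let ?i = "decode t x" let ?x = "sdrop (length (code t (decode t x))) x"
  have i: "?i \<in> A t" using decode_in Suc.prems by blast
  have p: "pre (E t x) (Suc n) = ?i # pre (E (d t ?i) ?x) n"
    by (subst E_conc) (rule pre_conc_Cons)
  have x: "x = conc (code t ?i) ?x" using pre_eq_conc decode_pre Suc.prems by blast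
  have r: "res t x (Suc n) = res (d t ?i) ?x n" by (simp add: res_def)
  have IH: "word (d t ?i) (pre (E (d t ?i) ?x) n)"
     "iter n (d t ?i) ?x = (dl (d t ?i) (pre (E (d t ?i) ?x) n), res (d t ?i) ?x n)"
     "?x = conc (encode (d t ?i) (pre (E (d t ?i) ?x) n)) (res (d t ?i) ?x n)"
    using Suc.IH[OF d_closed[OF Suc.prems i], of ?x] by blast+
  have "x = conc (encode t (pre (E t x) (Suc n))) (res t x (Suc n))"
    unfolding p r encode.simps conc_append using x IH(3) by simp
  moreover have "word t (pre (E t x) (Suc n))" unfolding p using i IH(1) by simp
  moreover have "iter (Suc n) t x = (dl t (pre (E t x) (Suc n)), res t x (Suc n))"
    unfolding p r using IH(2) by simp
  ultimately show ?case by blast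
qed

lemma E_L: "t \<in> Q \<Longrightarrow> E t x \<in> L t"
  unfolding L_def using iter_spec by blast

lemma conc_encode_res: "t \<in> Q \<Longrightarrow> conc (encode t (pre (E t x) n)) (res t x n) = x"
  using iter_spec[of t x n] by simp

lemma single_A:
  assumes "t \<in> Q" "single t" "i \<in> A t" shows "A t = {i}" "single (d t i)"
proof -
  obtain e where e: "L t = {e}" using assms(2) by (auto simp: single_def)
  have L1: "conc [j] p = e" if "j \<in> A t" "p \<in> L (d t j)" for j p
    using that e L_conc[of "[j]" p t] by auto
  have ne: "L (d t j) \<noteq> {}" if "j \<in> A t" for j using L_nonempty d_closed assms(1) that by blast
  have "j = e 0" if j: "j \<in> A t" for j
  proof -
    obtain p where "p \<in> L (d t j)" using ne[OF j] by blast
    then have "conc [j] p = e" using L1 j by blast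
    then show ?thesis using conc_Cons_0[of j "[]" p] by simp
  qed
  then show "A t = {i}" using assms(3) by auto
  obtain q where q: "q \<in> L (d t i)" using ne assms(3) by blast
  have "p = q" if "p \<in> L (d t i)" for p
    using L1[OF assms(3) that] L1[OF assms(3) q] by (metis conc_inject)
  then show "single (d t i)" unfolding single_def using q by blast
qed

text \<open>In a one-point language each state has a single letter, with empty code word, so reading
  stops for good.\<close>

lemma single_encode: "t \<in> Q \<Longrightarrow> single t \<Longrightarrow> word t v \<Longrightarrow> encode t v = [] \<and> single (dl t v)"
proof (induction v arbitrary: t)
  case (Cons i v)
  then have "A t = {i}" "single (d t i)" using single_A[of t i] by auto
  then show ?case using Cons code_Nil_iff[of t i] d_closed[of t i] by simp
qed simp

lemma single_mono:
  assumes "t \<in> Q" "p \<in> L t" "single (dl t (pre p m))" "m \<le> n"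
  shows "single (dl t (pre p n))"
proof -
  obtain k where k: "n = m + k" using assms(4) le_Suc_ex by blast
  have "word (dl t (pre p m)) (pre (sdrop m p) k)"
    using word_pre[OF assms(2), of n] by (simp add: k pre_add)
  then have "single (dl (dl t (pre p m)) (pre (sdrop m p) k))"
    using single_encode assms dl_closed word_pre by blast
  then show ?thesis by (simp add: k pre_add)
qed

lemma res_single:
  assumes "t \<in> Q" "single (dl t (pre (E t x) m))" "m \<le> n"
  shows "res t x n = res t x m"
proof -
  obtain k where k: "n = m + k" using assms(3) le_Suc_ex by blast
  let ?s = "dl t (pre (E t x) m)"
  have sQ: "?s \<in> Q" using dl_closed assms(1) iter_spec by blast
  have "res t x n = res ?s (res t x m) k"
    using iter_spec[OF assms(1), of x m] by (cases "iter m t x") (simp add: k res_def iter_add)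
  also have "\<dots> = res t x m"
    using iter_spec[OF sQ, of "res t x m" k] single_encode[OF sQ assms(2), of "pre (E ?s (res t x m)) k"]
    by (metis conc_Nil)
  finally show ?thesis .
qed

text \<open>Nothing is read once the language is a single point, so the least depth in the
  definition of \<open>left\<close> may be replaced by any later one.\<close>

lemma left_single:
  assumes "t \<in> Q" "single (dl t (pre (E t x) m))"
  shows "left t x = res t x m"
proof -
  have i: "isolated t (E t x)" using assms(2) by (auto simp: isolated_def)
  then have "single (dl t (pre (E t x) (LEAST n. single (dl t (pre (E t x) n)))))"
    unfolding isolated_def by (rule LeastI_ex)
  moreover have "(LEAST n. single (dl t (pre (E t x) n))) \<le> m" using assms(2) by (rule Least_le)
  ultimately show ?thesis using res_single[OF assms(1), of x _ m] i by (simp add: left_def)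
qed

lemma isolated_conc:
  assumes "t \<in> Q" "word t v" "p \<in> L (dl t v)"
  shows "isolated t (conc v p) \<longleftrightarrow> isolated (dl t v) p"
proof
  assume "isolated (dl t v) p"
  then obtain n where "single (dl (dl t v) (pre p n))" by (auto simp: isolated_def)
  then have "single (dl t (pre (conc v p) (length v + n)))" by (simp add: pre_conc_add)
  then show "isolated t (conc v p)" by (auto simp: isolated_def)
next
  assume "isolated t (conc v p)"
  then obtain n where "single (dl t (pre (conc v p) n))" by (auto simp: isolated_def)
  then have "single (dl t (pre (conc v p) (length v + n)))"
    using single_mono[OF assms(1), of "conc v p" n "length v + n"] assms by simp
  then show "isolated (dl t v) p" by (auto simp: isolated_def pre_conc_add)
qed

text \<open>Stripping an encoded prefix keeps the leftover bits; this allows lifts to be studied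
  inside one cone.\<close>

lemma left_encode:
  assumes "t \<in> Q" "word t v"
  shows "left t (conc (encode t v) y) = left (dl t v) y"
proof (cases "isolated (dl t v) (E (dl t v) y)")
  case False
  then show ?thesis using isolated_conc[OF assms E_L] dl_closed[OF assms] E_encode[OF assms]
    by (simp add: left_def)
next
  case True
  then obtain n where n: "single (dl (dl t v) (pre (E (dl t v) y) n))" by (auto simp: isolated_def)
  then have "single (dl t (pre (E t (conc (encode t v) y)) (length v + n)))"
    by (simp add: E_encode[OF assms] pre_conc_add)
  then have "left t (conc (encode t v) y) = res t (conc (encode t v) y) (length v + n)"
    using left_single assms(1) by blast
  also have "\<dots> = res (dl t v) y n" by (simp add: res_def iter_add iter_encode[OF assms])
  also have "\<dots> = left (dl t v) y" using left_single[OF dl_closed[OF assms] n] by simp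
  finally show ?thesis .
qed

lemma single_E_left: "t \<in> Q \<Longrightarrow> single t \<Longrightarrow> left t x = x"
  using left_single[of t x 0] by (simp add: res_def)

lemma continuous_on_E:
  assumes "t \<in> Q" shows "continuous_on UNIV (E t)"
  unfolding continuous_on_pre_iff
proof (intro ballI allI)
  fix x n
  let ?v = "pre (E t x) n"
  have "pre (E t x') n = ?v" if "pre x' (length (encode t ?v)) = pre x (length (encode t ?v))" for x'
  proof -
    have "pre x (length (encode t ?v)) = encode t ?v"
      using conc_encode_res[OF assms, of x n] pre_conc_length by metis
    then have "x' = conc (encode t ?v) (sdrop (length (encode t ?v)) x')"
      using pre_eq_conc that by metis
    then have "E t x' = conc ?v (E (dl t ?v) (sdrop (length (encode t ?v)) x'))"
      using E_encode[OF assms word_pre[OF E_L[OF assms]]] by metis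
    then show ?thesis using pre_conc_length[of ?v] by simp
  qed
  then show "\<exists>m. \<forall>x'\<in>UNIV. pre x' m = pre x m \<longrightarrow> pre (E t x') n = pre (E t x) n" by blast
qed

text \<open>An empty code word means a single child, so no other path can leave p at any
  depth.\<close>

lemma singleI_encode:
  assumes t: "t \<in> Q" and p: "p \<in> L t" and g: "\<And>k. encode t (pre p k) = []"
  shows "single t"
proof -
  have "pre p' k = pre p k" if p': "p' \<in> L t" for p' k
  proof (induction k)
    case (Suc k)
    let ?s = "dl t (pre p k)"
    have A: "p k \<in> A ?s" "p' k \<in> A ?s"
      using word_pre[OF p, of "Suc k"] word_pre[OF p', of "Suc k"] Suc by (simp_all add: pre_Suc)
    have sQ: "?s \<in> Q" using dl_closed t word_pre[OF p] by blast
    have "code ?s (p k) = []" using g[of "Suc k"] by (simp add: pre_Suc encode_append)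
    then have "card (A ?s) = 1" using code_Nil_iff[OF sQ A(1)] by simp
    then have "p' k = p k" using A by (auto simp: card_1_singleton_iff)
    then show ?case using Suc by (simp add: pre_Suc)
  qed simp
  then have "L t = {p}" using p ext_pre by blast
  then show ?thesis by (auto simp: single_def)
qed

text \<open>No state along a non-isolated path has a one-point language, so by
  \<open>singleI_encode\<close> a further bit is always read later.\<close>

lemma encode_unbounded:
  assumes t: "t \<in> Q" and p: "p \<in> L t" "\<not> isolated t p"
  shows "\<exists>n. N \<le> length (encode t (pre p n))"
proof (induction N)
  case (Suc N)
  then obtain n where n: "N \<le> length (encode t (pre p n))" by blast
  let ?s = "dl t (pre p n)"
  have "\<not> single ?s" using p(2) by (auto simp: isolated_def)
  then obtain k where "encode ?s (pre (sdrop n p) k) \<noteq> []"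
    using singleI_encode[OF _ L_sdrop[OF p(1)]] dl_closed[OF t word_pre[OF p(1)]] by blast
  then have "length (encode ?s (pre (sdrop n p) k)) \<ge> 1" by (simp add: Suc_le_eq)
  then have "Suc N \<le> length (encode t (pre p (n + k)))" using n by (simp add: pre_add encode_append)
  then show ?case by blast
qed simp

lemma encode_pre_mono: "m \<le> n \<Longrightarrow> \<exists>z. encode t (pre p n) = encode t (pre p m) @ z"
  using le_Suc_ex[of m n] by (auto simp: pre_add encode_append)

text \<open>Over an isolated path x is the consumed prefix followed by the leftover bits. Elsewhere
  each bit of x is consumed at some depth, hence determined by the decoded path.\<close>

lemma E_left_inject:
  assumes t: "t \<in> Q" and eq: "E t x = E t x'" "left t x = left t x'"
  shows "x = x'"
proof (cases "isolated t (E t x)")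
  case True
  then obtain n where n: "single (dl t (pre (E t x) n))" by (auto simp: isolated_def)
  then have "res t x n = res t x' n" using left_single[OF t] eq by metis
  then show ?thesis using conc_encode_res[OF t] eq(1) by metis
next
  case False
  show ?thesis
  proof
    fix k
    obtain n where n: "Suc k \<le> length (encode t (pre (E t x) n))"
      using encode_unbounded[OF t E_L[OF t] False] by blast
    let ?g = "encode t (pre (E t x) n)"
    have "x k = ?g ! k" using conc_encode_res[OF t, of x n] n by (metis Suc_le_eq conc_def)
    moreover have "x' k = ?g ! k" using conc_encode_res[OF t, of x' n] n eq(1) by (metis Suc_le_eq conc_def)
    ultimately show "x k = x' k" by simp
  qed
qed

text \<open>With \<open>E_left_inject\<close> this identifies binary words with pairs (p, r), where
  r is free over isolated p and equal to the default word elsewhere.\<close>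

lemma E_left_surj:
  assumes t: "t \<in> Q" and p: "p \<in> L t" and r: "\<not> isolated t p \<Longrightarrow> r = (\<lambda>_. False)"
  shows "\<exists>x. E t x = p \<and> left t x = r"
proof (cases "isolated t p")
  case True
  then obtain n where n: "single (dl t (pre p n))" by (auto simp: isolated_def)
  let ?s = "dl t (pre p n)"
  have w: "word t (pre p n)" by (rule word_pre[OF p])
  have sQ: "?s \<in> Q" by (rule dl_closed[OF t w])
  have "E ?s r = sdrop n p" using single_L[OF n L_sdrop[OF p]] E_L[OF sQ] by blast
  then have "E t (conc (encode t (pre p n)) r) = p" using E_encode[OF t w] by simp
  moreover have "left t (conc (encode t (pre p n)) r) = r" using left_encode[OF t w] single_E_left[OF sQ n] by simp
  ultimately show ?thesis by blast
next
  case False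
  have "\<forall>k. \<exists>n. Suc k \<le> length (encode t (pre p n))" using encode_unbounded[OF t p False] by blast
  \<comment> \<open>N k is a depth at which bit k has been read. The codes of prefixes of p extend
    one another, so bit k does not depend on the depth.\<close>
  then obtain N where N: "\<And>k. Suc k \<le> length (encode t (pre p (N k)))" by metis
  define x where "x k = encode t (pre p (N k)) ! k" for k
  have "pre x (length (encode t (pre p n))) = encode t (pre p n)" for n
  proof (rule nth_equalityI)
    fix k assume "k < length (pre x (length (encode t (pre p n))))"
    then have k: "k < length (encode t (pre p n))" by simp
    have "k < length (encode t (pre p (N k)))" using N[of k] by simp
    then have "encode t (pre p (N k)) ! k = encode t (pre p n) ! k"
      using encode_pre_mono[of n "N k" t p] encode_pre_mono[of "N k" n t p] k
      by (metis nat_le_linear nth_append)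
    then show "pre x (length (encode t (pre p n))) ! k = encode t (pre p n) ! k" using k by (simp add: x_def)
  qed simp
  then have "E t x = conc (pre p n) (E (dl t (pre p n)) (sdrop (length (encode t (pre p n))) x))" for n
    using E_encode[OF t word_pre[OF p]] pre_eq_conc by metis
  then have "pre (E t x) n = pre p n" for n by (metis length_pre pre_conc_length)
  then have "E t x = p" by (rule ext_pre)
  then show ?thesis using False r by (auto simp: left_def)
qed

lemma E_image: "t \<in> Q \<Longrightarrow> E t ` UNIV = L t"
  using E_L E_left_surj by (metis (no_types, lifting) image_subset_iff rangeI subsetI subset_antisym)

lemma not_isolated_left: "\<not> isolated t (E t x) \<Longrightarrow> left t x = (\<lambda>_. False)"
  by (simp add: left_def)

section \<open>Lifting homeomorphisms to binary words\<close>

definition lift :: "'k \<Rightarrow> ((nat \<Rightarrow> nat) \<Rightarrow> nat \<Rightarrow> nat) \<Rightarrow> (nat \<Rightarrow> bool) \<Rightarrow> nat \<Rightarrow> bool" where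
  "lift t f x = (THE y. E t y = f (E t x) \<and> left t y = left t x)"

text \<open>Uniqueness reduces identities between lifts, in particular compatibility with
  composition, to a check of the two coordinates.\<close>

lemma lift_eqI: "t \<in> Q \<Longrightarrow> E t y = f (E t x) \<Longrightarrow> left t y = left t x \<Longrightarrow> lift t f x = y"
  unfolding lift_def by (rule the_equality) (auto intro: E_left_inject)

text \<open>The required pair of coordinates is admissible: if the image path is not isolated,
  neither is the source path, whose leftover bits then have the default value.\<close>

lemma lift_spec:
  assumes t: "t \<in> Q" and fg: "homeomorphism (L t) (L t) f g"
  shows "E t (lift t f x) = f (E t x)" "left t (lift t f x) = left t x"
proof -
  have "f (E t x) \<in> L t" using fg E_L[OF t] by (auto simp: homeomorphism_def)
  moreover have "left t x = (\<lambda>_. False)" if "\<not> isolated t (f (E t x))"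
    using homeo_isolated[OF fg E_L[OF t]] not_isolated_left that by blast
  ultimately obtain y where y: "E t y = f (E t x)" "left t y = left t x"
    using E_left_surj[OF t] by blast
  then show "E t (lift t f x) = f (E t x)" "left t (lift t f x) = left t x"
    using lift_eqI[of t y f x] t y by simp_all
qed

lemma lift_cong:
  assumes "t \<in> Q" "\<And>p. p \<in> L t \<Longrightarrow> f p = g p"
  shows "lift t f = lift t g"
  unfolding lift_def using assms(2)[OF E_L[OF assms(1)]] by simp

lemma lift_compose:
  assumes t: "t \<in> Q" and f: "homeomorphism (L t) (L t) f f'" and g: "homeomorphism (L t) (L t) g g'"
  shows "lift t (\<lambda>p. f (g p)) = lift t f \<circ> lift t g"
proof
  fix x show "lift t (\<lambda>p. f (g p)) x = (lift t f \<circ> lift t g) x"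
    by (rule lift_eqI[OF t]) (simp_all add: lift_spec[OF t f] lift_spec[OF t g])
qed

lemma lift_id: "t \<in> Q \<Longrightarrow> lift t (\<lambda>p. p) = id"
  by (rule ext) (rule lift_eqI, simp_all)

text \<open>Over a one-point cone all further bits are leftover, at the source as well as at the
  isolated image, so the lift just exchanges two encoded prefixes.\<close>

lemma lift_single:
  assumes t: "t \<in> Q" and fg: "homeomorphism (L t) (L t) f g" and v: "word t v" "single (dl t v)"
  obtains y where "\<And>z. lift t f (conc (encode t v) z) = conc y z"
proof -
  obtain e where e: "L (dl t v) = {e}" using v(2) by (auto simp: single_def)
  have sQ: "dl t v \<in> Q" by (rule dl_closed[OF t v(1)])
  have p: "conc v e \<in> L t" using v e by simp
  let ?q = "f (conc v e)"
  have q: "?q \<in> L t" using fg p by (auto simp: homeomorphism_def)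
  have "isolated t (conc v e)" unfolding isolated_def using v(2) by (metis pre_conc_length)
  then obtain n where n: "single (dl t (pre ?q n))" using homeo_isolated[OF fg p] unfolding isolated_def by blast
  let ?y = "pre ?q n"
  have wy: "word t ?y" by (rule word_pre[OF q])
  have rQ: "dl t ?y \<in> Q" by (rule dl_closed[OF t wy])
  have "lift t f (conc (encode t v) z) = conc (encode t ?y) z" for z
  proof (rule lift_eqI[OF t])
    have "E (dl t v) z = e" using E_L[OF sQ] e by blast
    then have "f (E t (conc (encode t v) z)) = ?q" by (simp add: E_encode[OF t v(1)])
    moreover have "E (dl t ?y) z = sdrop n ?q" using E_L[OF rQ] single_L[OF n L_sdrop[OF q]] by blast
    then have "E t (conc (encode t ?y) z) = ?q" by (simp add: E_encode[OF t wy])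
    ultimately show "E t (conc (encode t ?y) z) = f (E t (conc (encode t v) z))" by simp
    show "left t (conc (encode t ?y) z) = left t (conc (encode t v) z)"
      by (simp add: left_encode[OF t v(1)] left_encode[OF t wy] single_E_left[OF sQ v(2)] single_E_left[OF rQ n])
  qed
  then show thesis by (rule that)
qed

text \<open>Near a word over an isolated path the lift exchanges prefixes. Elsewhere the image path
  is not isolated either, so each output bit is fixed by a finite prefix of the image path, which
  depends continuously on x.\<close>

lemma continuous_on_lift:
  assumes t: "t \<in> Q" and fg: "homeomorphism (L t) (L t) f g"
  shows "continuous_on UNIV (lift t f)"
  unfolding continuous_on_pre_iff
proof (intro ballI allI)
  fix x n
  show "\<exists>m. \<forall>x'\<in>UNIV. pre x' m = pre x m \<longrightarrow> pre (lift t f x') n = pre (lift t f x) n"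
  proof (cases "isolated t (E t x)")
    case True
    then obtain k where k: "single (dl t (pre (E t x) k))" by (auto simp: isolated_def)
    let ?g = "encode t (pre (E t x) k)"
    obtain y where y: "\<And>z. lift t f (conc ?g z) = conc y z"
      using lift_single[OF t fg word_pre[OF E_L[OF t]] k] by blast
    have x: "x = conc ?g (res t x k)" by (simp add: conc_encode_res[OF t])
    have "pre (lift t f x') n = pre (lift t f x) n"
      if x': "pre x' (length ?g + n) = pre x (length ?g + n)" for x'
    proof -
      define z where "z = res t x k"
      define z' where "z' = sdrop (length ?g) x'"
      have "pre x (length ?g + n) = ?g @ pre z n" using pre_conc_add[of ?g z n] x z_def by simp
      moreover have "pre x' (length ?g + n) = pre x' (length ?g) @ pre z' n" by (simp add: pre_add z'_def)
      ultimately have e: "pre x' (length ?g) = ?g" "pre z' n = pre z n" using x' by (simp_all add: append_eq_append_conv)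
      have "x' = conc ?g z'" unfolding z'_def by (rule pre_eq_conc[OF e(1)])
      moreover have "x = conc ?g z" using x z_def by simp
      ultimately have "lift t f x' = conc y z'" "lift t f x = conc y z" using y by metis+
      moreover have "pre (conc y z') (length y + n) = pre (conc y z) (length y + n)"
        by (simp add: pre_conc_add e(2))
      ultimately show ?thesis using pre_eq_mono le_add2 by metis
    qed
    then show ?thesis by blast
  next
    case False
    let ?p = "f (E t x)"
    have p: "?p \<in> L t" using fg E_L[OF t] by (auto simp: homeomorphism_def)
    have "\<not> isolated t ?p"
    proof
      assume "isolated t ?p"
      then have "isolated t (g ?p)" by (rule homeo_isolated[OF homeomorphism_symD[OF fg] p])
      then show False using False fg E_L[OF t] by (simp add: homeomorphism_def)
    qed
    then obtain m where m: "n \<le> length (encode t (pre ?p m))" using encode_unbounded[OF t p] by blast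
    have "continuous_on (L t) f" using fg by (simp add: homeomorphism_def)
    then have "continuous_on UNIV (\<lambda>x. f (E t x))"
      by (rule continuous_on_compose2[OF _ continuous_on_E[OF t]]) (use E_L[OF t] in auto)
    then obtain k where k: "\<And>x'. pre x' k = pre x k \<Longrightarrow> pre (f (E t x')) m = pre ?p m"
      using continuous_on_preD[of UNIV "\<lambda>x. f (E t x)" x m] by auto
    have pl: "pre (lift t f x') n = take n (encode t (pre ?p m))" if "pre x' k = pre x k" for x'
    proof -
      have "conc (encode t (pre (E t (lift t f x')) m)) (res t (lift t f x') m) = lift t f x'"
        by (rule conc_encode_res[OF t])
      then show ?thesis using pre_conc_le[OF m] k[OF that] lift_spec[OF t fg] by metis
    qed
    have "\<forall>x'. pre x' k = pre x k \<longrightarrow> pre (lift t f x') n = pre (lift t f x) n"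
      using pl by simp
    then show ?thesis by blast
  qed
qed

lemma homeomorphism_lift:
  assumes t: "t \<in> Q" and fg: "homeomorphism (L t) (L t) f g"
  shows "homeomorphism UNIV UNIV (lift t f) (lift t g)"
proof -
  have gf: "homeomorphism (L t) (L t) g f" using fg by (rule homeomorphism_symD)
  have 1: "lift t f (lift t g x) = x" for x
  proof -
    have "lift t f (lift t g x) = lift t (\<lambda>p. f (g p)) x" using lift_compose[OF t fg gf] by simp
    also have "lift t (\<lambda>p. f (g p)) = lift t (\<lambda>p. p)"
      by (rule lift_cong[OF t]) (use fg in \<open>simp add: homeomorphism_def\<close>)
    finally show ?thesis by (simp add: lift_id[OF t])
  qed
  have 2: "lift t g (lift t f x) = x" for x
  proof -
    have "lift t g (lift t f x) = lift t (\<lambda>p. g (f p)) x" using lift_compose[OF t gf fg] by simp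
    also have "lift t (\<lambda>p. g (f p)) = lift t (\<lambda>p. p)"
      by (rule lift_cong[OF t]) (use fg in \<open>simp add: homeomorphism_def\<close>)
    finally show ?thesis by (simp add: lift_id[OF t])
  qed
  have "surj (lift t f)" "surj (lift t g)" using 1 2 by (metis surjI)+
  then show ?thesis
    by (simp add: homeomorphism_def 1 2 continuous_on_lift[OF t fg] continuous_on_lift[OF t gf])
qed

text \<open>A binary word may end in the middle of a code word, whereas \<open>loc_fin\<close>
  speaks of cones of the tree. The remainder u is bounded by the code lengths, except where nothing
  more is read.\<close>

lemma encode_decompose:
  assumes t: "t \<in> Q" and C: "\<And>s i. s \<in> Q \<Longrightarrow> i \<in> A s \<Longrightarrow> length (code s i) \<le> C"
  obtains v u where "word t v" "w = encode t v @ u" "length u \<le> C \<or> single (dl t v)"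
proof -
  \<comment> \<open>Any infinite continuation would do; it only serves to run the decoder along
    w.\<close>
  define x where "x = conc w (\<lambda>_. False)"
  let ?p = "E t x"
  have p: "?p \<in> L t" by (rule E_L[OF t])
  have pref: "\<exists>u. w = encode t (pre ?p n) @ u" if n: "length (encode t (pre ?p n)) \<le> length w" for n
  proof -
    have "conc (encode t (pre ?p n)) (res t x n) = conc w (\<lambda>_. False)"
      using conc_encode_res[OF t] x_def by simp
    then show ?thesis using conc_eqD n by metis
  qed
  show thesis
  proof (cases "\<exists>n. single (dl t (pre ?p n)) \<and> length (encode t (pre ?p n)) \<le> length w")
    case True
    then show thesis using pref that word_pre[OF p] by metis
  next
    case False
    have ex: "\<exists>n. length w < length (encode t (pre ?p n))"
    proof (cases "isolated t ?p")
      case True then show ?thesis using False by (auto simp: isolated_def not_le)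
    next
      case nf: False
      then show ?thesis using encode_unbounded[OF t p nf, of "Suc (length w)"] by (auto simp: Suc_le_eq)
    qed
    \<comment> \<open>The first depth whose code is longer than w; it is positive, and one step
      earlier the code is still a prefix of w.\<close>
    define n where "n = (LEAST n. length w < length (encode t (pre ?p n)))"
    have n: "length w < length (encode t (pre ?p n))" unfolding n_def by (rule LeastI_ex[OF ex])
    then obtain m where m: "n = Suc m" by (cases n) auto
    have le: "length (encode t (pre ?p m)) \<le> length w"
      using not_less_Least[of m "\<lambda>n. length w < length (encode t (pre ?p n))"] m n_def by simp
    obtain u where u: "w = encode t (pre ?p m) @ u" using pref[OF le] by blast
    have wm: "word t (pre ?p m)" "?p m \<in> A (dl t (pre ?p m))"
      using word_pre[OF p, of "Suc m"] by (simp_all add: pre_Suc)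
    have "length u < length (code (dl t (pre ?p m)) (?p m))"
      using n u by (simp add: m pre_Suc encode_append)
    also have "\<dots> \<le> C" using C wm dl_closed[OF t] by blast
    finally show thesis using that[OF wm(1) u] by simp
  qed
qed

lemma code_bounded:
  obtains C where "\<And>s i. s \<in> Q \<Longrightarrow> i \<in> A s \<Longrightarrow> length (code s i) \<le> C"
proof -
  have "finite (Sigma Q A)" using finite_Q finite_A by simp
  then obtain C where C: "\<And>si. si \<in> Sigma Q A \<Longrightarrow> length (code (fst si) (snd si)) \<le> C"
    using finite_uniform_bound[of "Sigma Q A" "\<lambda>si C. length (code (fst si) (snd si)) \<le> C"]
    by (metis order_trans order_refl)
  show thesis by (rule that[of C]) (use C in force)
qed

lemma lift_computed:
  assumes t: "t \<in> Q" and fg: "homeomorphism (L t) (L t) f g" and f: "loc_fin t f"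
  shows "computed_by_transducer (lift t f)"
proof -
  obtain S where S: "finite S"
    "\<And>v. word t v \<Longrightarrow> \<exists>x. \<exists>h\<in>S. \<forall>p\<in>L (dl t v). f (conc v p) = conc x (h p)"
    using f unfolding loc_fin_def by blast
  obtain C where C: "\<And>s i. s \<in> Q \<Longrightarrow> i \<in> A s \<Longrightarrow> length (code s i) \<le> C" using code_bounded by blast
  define U where "U = {u :: bool list. length u \<le> C}"
  have "finite {u :: bool list. set u \<subseteq> UNIV \<and> length u \<le> C}" by (rule finite_lists_length_le) simp
  then have finU: "finite U" by (simp add: U_def)
  \<comment> \<open>The local action of the lift depends on w only through (h, s, r, u), which range
    over finite sets; so it is chosen before w is fixed.\<close>
  define H where "H h s r u x = (SOME y. E r y = h (E s (conc u x)) \<and> left r y = left s (conc u x))"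
    for h s r u x
  define \<H> where "\<H> = insert (\<lambda>x. x) ((\<lambda>(h, s, r, u). H h s r u) ` (S \<times> Q \<times> Q \<times> U))"
  have "finite \<H>" unfolding \<H>_def using S(1) finite_Q finU by simp
  moreover have "\<exists>y. \<exists>K\<in>\<H>. \<forall>x. lift t f (conc w x) = conc y (K x)" for w
  proof -
    obtain v u where v: "word t v" "w = encode t v @ u" "length u \<le> C \<or> single (dl t v)"
      using encode_decompose[OF t C] by blast
    show ?thesis
    proof (cases "single (dl t v)")
      case True
      obtain y where "\<And>z. lift t f (conc (encode t v) z) = conc y z" using lift_single[OF t fg v(1) True] by blast
      then have "lift t f (conc w x) = conc (y @ u) x" for x by (simp add: v(2) conc_append)
      then show ?thesis unfolding \<H>_def by (intro exI[of _ "y @ u"] bexI[of _ "\<lambda>x. x"]) simp_all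
    next
      case False
      then have u: "u \<in> U" using v(3) by (simp add: U_def)
      let ?s = "dl t v"
      have sQ: "?s \<in> Q" by (rule dl_closed[OF t v(1)])
      obtain y h where h: "h \<in> S" "\<And>p. p \<in> L ?s \<Longrightarrow> f (conc v p) = conc y (h p)"
        using S(2)[OF v(1)] by blast
      have im: "conc y (h p) \<in> L t" if "p \<in> L ?s" for p
      proof -
        have "conc v p \<in> L t" using that v(1) by simp
        then have "f (conc v p) \<in> L t" using fg by (auto simp: homeomorphism_def)
        then show ?thesis using h(2)[OF that] by simp
      qed
      obtain p0 where "p0 \<in> L ?s" using L_nonempty[OF sQ] by blast
      then have wy: "word t y" using im by auto
      let ?r = "dl t y"
      have rQ: "?r \<in> Q" by (rule dl_closed[OF t wy])
      have "lift t f (conc w x) = conc (encode t y) (H h ?s ?r u x)" for x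
      proof (rule lift_eqI[OF t])
        let ?q = "E ?s (conc u x)"
        have q: "?q \<in> L ?s" by (rule E_L[OF sQ])
        have hq: "h ?q \<in> L ?r" using im[OF q] by simp
        have E: "E t (conc w x) = conc v ?q" by (simp add: v(2) conc_append E_encode[OF t v(1)])
        have l: "left t (conc w x) = left ?s (conc u x)" by (simp add: v(2) conc_append left_encode[OF t v(1)])
        \<comment> \<open>Isolation passes between a cone and the whole language, so
          \<open>homeo_isolated\<close> for f also controls its local map h.\<close>
        have "left ?s (conc u x) = (\<lambda>_. False)" if "\<not> isolated ?r (h ?q)"
        proof -
          have "\<not> isolated t (f (conc v ?q))" using that isolated_conc[OF t wy hq] h(2)[OF q] by simp
          then have "\<not> isolated t (conc v ?q)" using homeo_isolated[OF fg] q v(1) by (metis L_conc)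
          then show ?thesis using isolated_conc[OF t v(1) q] not_isolated_left by blast
        qed
        then have "\<exists>y. E ?r y = h ?q \<and> left ?r y = left ?s (conc u x)"
          using E_left_surj[OF rQ hq] by blast
        then have H: "E ?r (H h ?s ?r u x) = h ?q" "left ?r (H h ?s ?r u x) = left ?s (conc u x)"
          unfolding H_def by (metis (mono_tags, lifting) someI_ex)+
        show "E t (conc (encode t y) (H h ?s ?r u x)) = f (E t (conc w x))"
          by (simp add: E_encode[OF t wy] H E h(2)[OF q])
        show "left t (conc (encode t y) (H h ?s ?r u x)) = left t (conc w x)"
          by (simp add: left_encode[OF t wy] H l)
      qed
      moreover have "H h ?s ?r u \<in> \<H>"
        unfolding \<H>_def using h(1) sQ rQ u by (intro insertI2 image_eqI[of _ _ "(h, ?s, ?r, u)"]) auto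
      ultimately show ?thesis by blast
    qed
  qed
  moreover have "inj (lift t f)"
    using homeomorphism_lift[OF t fg] unfolding homeomorphism_def by (metis UNIV_I injI)
  ultimately show ?thesis
    by (intro computed_by_transducerI[OF continuous_on_lift[OF t fg]]) auto
qed

lemma lift_R2:
  assumes "t \<in> Q" "homeomorphism (L t) (L t) f g" "loc_fin t f"
  shows "lift t f \<in> R2_set"
  unfolding R2_set_def using homeomorphism_lift lift_computed assms by blast

end

section \<open>Rigid coordinates on a self-similar tree\<close>

text \<open>The extension to infinite words of a map on finite words that preserves lengths and
  prefixes; entry n is then final after n + 1 letters.\<close>

definition limit :: "('a list \<Rightarrow> 'b list) \<Rightarrow> (nat \<Rightarrow> 'a) \<Rightarrow> nat \<Rightarrow> 'b" where
  "limit F p n = F (pre p (Suc n)) ! n"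

lemma pre_limit:
  assumes "\<And>n. length (F (pre p n)) = n" "\<And>n. take n (F (pre p (Suc n))) = F (pre p n)"
  shows "pre (limit F p) n = F (pre p n)"
proof (induction n)
  case 0 then show ?case using assms(1)[of 0] by simp
next
  case (Suc n)
  have "F (pre p (Suc n)) = take n (F (pre p (Suc n))) @ [F (pre p (Suc n)) ! n]"
    using take_Suc_conv_app_nth[of n "F (pre p (Suc n))"] assms(1)[of "Suc n"] by simp
  then show ?case unfolding pre_Suc[of "limit F p"] Suc using assms(2)[of n] by (simp add: limit_def)
qed

locale self_similar_tree =
  fixes T :: "nat list set" and tp :: "nat list \<Rightarrow> 'k"
    and Mor :: "nat list \<Rightarrow> nat list \<Rightarrow> (nat list \<Rightarrow> nat list) set"
  assumes self_similar: "self_similar T tp Mor" and no_dead_ends: "no_dead_ends T"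
begin

lemma rooted: "rooted_lf_tree T"
  using self_similar unfolding self_similar_def by (elim conjE)

lemma finite_types: "finite (tp ` T)"
  using self_similar unfolding self_similar_def by (elim conjE)

lemma root_T: "[] \<in> T" and T_butlast: "v @ [i] \<in> T \<Longrightarrow> v \<in> T"
  and finite_children: "v \<in> T \<Longrightarrow> finite {i. v @ [i] \<in> T}"
  using rooted unfolding rooted_lf_tree_def by (simp, blast, simp)

lemma T_prefix: "u @ z \<in> T \<Longrightarrow> u \<in> T"
proof (induction z rule: rev_induct)
  case (snoc i z) then show ?case using T_butlast[of "u @ z" i] by simp
qed simp

lemma Mor_nonempty: "u \<in> T \<Longrightarrow> v \<in> T \<Longrightarrow> tp u = tp v \<Longrightarrow> Mor u v \<noteq> {}"
  and finite_Mor: "u \<in> T \<Longrightarrow> v \<in> T \<Longrightarrow> tp u = tp v \<Longrightarrow> finite (Mor u v)"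
  and Mor_morph: "u \<in> T \<Longrightarrow> v \<in> T \<Longrightarrow> tp u = tp v \<Longrightarrow> \<phi> \<in> Mor u v \<Longrightarrow> is_morph T tp u v \<phi>"
  using self_similar unfolding self_similar_def by simp_all

lemma Mor_inv: "u \<in> T \<Longrightarrow> v \<in> T \<Longrightarrow> tp u = tp v \<Longrightarrow> \<phi> \<in> Mor u v \<Longrightarrow>
    (\<lambda>y\<in>subtree T v. inv_into (subtree T u) \<phi> y) \<in> Mor v u"
  using self_similar unfolding self_similar_def by (elim conjE) simp

lemma Mor_comp: "u \<in> T \<Longrightarrow> v \<in> T \<Longrightarrow> w \<in> T \<Longrightarrow> tp u = tp v \<Longrightarrow> tp v = tp w \<Longrightarrow> \<phi> \<in> Mor u v \<Longrightarrow>
    \<psi> \<in> Mor v w \<Longrightarrow> compose (subtree T u) \<psi> \<phi> \<in> Mor u w"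
proof -
  have "\<forall>u\<in>T. \<forall>v\<in>T. \<forall>w\<in>T. tp u = tp v \<and> tp v = tp w \<longrightarrow>
      (\<forall>\<phi>\<in>Mor u v. \<forall>\<psi>\<in>Mor v w. compose (subtree T u) \<psi> \<phi> \<in> Mor u w)"
    using self_similar unfolding self_similar_def by (elim conjE)
  then show "u \<in> T \<Longrightarrow> v \<in> T \<Longrightarrow> w \<in> T \<Longrightarrow> tp u = tp v \<Longrightarrow> tp v = tp w \<Longrightarrow> \<phi> \<in> Mor u v \<Longrightarrow>
    \<psi> \<in> Mor v w \<Longrightarrow> compose (subtree T u) \<psi> \<phi> \<in> Mor u w" by blast
qed

lemma Mor_restr: "v \<in> T \<Longrightarrow> w \<in> T \<Longrightarrow> tp v = tp w \<Longrightarrow> \<phi> \<in> Mor v w \<Longrightarrow> u \<in> subtree T v \<Longrightarrow>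
    restrict \<phi> (subtree T u) \<in> Mor u (\<phi> u)"
proof -
  have "\<forall>v\<in>T. \<forall>w\<in>T. tp v = tp w \<longrightarrow> (\<forall>\<phi>\<in>Mor v w. \<forall>u\<in>subtree T v.
      restrict \<phi> (subtree T u) \<in> Mor u (\<phi> u))"
    using self_similar unfolding self_similar_def by (elim conjE)
  then show "v \<in> T \<Longrightarrow> w \<in> T \<Longrightarrow> tp v = tp w \<Longrightarrow> \<phi> \<in> Mor v w \<Longrightarrow> u \<in> subtree T v \<Longrightarrow>
    restrict \<phi> (subtree T u) \<in> Mor u (\<phi> u)" by blast
qed

lemma subtree_T: "x \<in> subtree T u \<Longrightarrow> x \<in> T"
  by (simp add: subtree_def)

lemma subtree_self: "u \<in> T \<Longrightarrow> u \<in> subtree T u"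
  by (simp add: subtree_def)

lemma subtree_root: "subtree T [] = T"
  by (simp add: subtree_def)

lemma subtree_append: "x \<in> subtree T u \<Longrightarrow> x @ z \<in> T \<Longrightarrow> x @ z \<in> subtree T u"
  by (auto simp: subtree_def)

section \<open>Composing, restricting and transporting morphisms\<close>

definition MorT :: "nat list \<Rightarrow> nat list \<Rightarrow> (nat list \<Rightarrow> nat list) \<Rightarrow> bool" where
  "MorT u v \<phi> \<longleftrightarrow> u \<in> T \<and> v \<in> T \<and> tp u = tp v \<and> \<phi> \<in> Mor u v"

lemma MorT_bij: "MorT u v \<phi> \<Longrightarrow> bij_betw \<phi> (subtree T u) (subtree T v)"
  and MorT_root: "MorT u v \<phi> \<Longrightarrow> \<phi> u = v"
  and MorT_tp: "MorT u v \<phi> \<Longrightarrow> x \<in> subtree T u \<Longrightarrow> tp (\<phi> x) = tp x"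
  using Mor_morph unfolding MorT_def is_morph_def by blast+

lemma MorT_in: "MorT u v \<phi> \<Longrightarrow> x \<in> subtree T u \<Longrightarrow> \<phi> x \<in> subtree T v"
  using MorT_bij bij_betwE by blast

lemma MorT_child:
  assumes "MorT u v \<phi>" "x \<in> subtree T u" "x @ [i] \<in> T"
  shows "\<exists>j. \<phi> (x @ [i]) = \<phi> x @ [j]"
proof -
  have "\<forall>x\<in>subtree T u. \<forall>y\<in>subtree T u. (\<exists>i. y = x @ [i]) \<longleftrightarrow> (\<exists>j. \<phi> y = \<phi> x @ [j])"
    using assms(1) Mor_morph unfolding MorT_def is_morph_def by blast
  then show ?thesis using assms(2) subtree_append[OF assms(2,3)] by blast
qed

lemma MorT_append:
  assumes "MorT u v \<phi>" "x \<in> subtree T u" "x @ z \<in> T"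
  shows "\<exists>z'. \<phi> (x @ z) = \<phi> x @ z' \<and> length z' = length z"
  using assms(3)
proof (induction z rule: rev_induct)
  case (snoc i z)
  have xz: "x @ z \<in> T" using snoc.prems T_butlast[of "x @ z" i] by simp
  obtain z' where z': "\<phi> (x @ z) = \<phi> x @ z'" "length z' = length z" using snoc.IH[OF xz] by blast
  obtain j where "\<phi> ((x @ z) @ [i]) = \<phi> (x @ z) @ [j]"
    using MorT_child[OF assms(1) subtree_append[OF assms(2) xz], of i] snoc.prems by auto
  then show ?case using z' by (intro exI[of _ "z' @ [j]"]) simp
qed simp

lemma MorT_inv: "MorT u v \<phi> \<Longrightarrow> MorT v u (\<lambda>y\<in>subtree T v. inv_into (subtree T u) \<phi> y)"
  unfolding MorT_def using Mor_inv by simp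

lemma MorT_inv_eq:
  assumes "MorT u v \<phi>" "y \<in> subtree T v"
  shows "\<phi> ((\<lambda>y\<in>subtree T v. inv_into (subtree T u) \<phi> y) y) = y"
  using MorT_bij[OF assms(1)] assms(2) by (simp add: bij_betw_inv_into_right)

lemma MorT_inv_eq':
  assumes "MorT u v \<phi>" "x \<in> subtree T u"
  shows "(\<lambda>y\<in>subtree T v. inv_into (subtree T u) \<phi> y) (\<phi> x) = x"
  using MorT_bij[OF assms(1)] MorT_in[OF assms] assms(2) by (simp add: bij_betw_inv_into_left)

lemma MorT_comp: "MorT u v \<phi> \<Longrightarrow> MorT v w \<psi> \<Longrightarrow> MorT u w (compose (subtree T u) \<psi> \<phi>)"
  unfolding MorT_def using Mor_comp[of u v w \<phi> \<psi>] by simp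

lemma MorT_restr:
  assumes "MorT v w \<phi>" "u \<in> subtree T v" shows "MorT u (\<phi> u) (restrict \<phi> (subtree T u))"
proof -
  have "\<phi> u \<in> T" by (rule subtree_T[OF MorT_in[OF assms]])
  moreover have "u \<in> T" by (rule subtree_T[OF assms(2)])
  ultimately show ?thesis using MorT_tp[OF assms] assms unfolding MorT_def using Mor_restr by auto
qed

text \<open>Identities come from nonemptiness of \<open>Mor u u\<close>: compose any element with
  its inverse.\<close>

lemma MorT_id:
  assumes "u \<in> T" shows "MorT u u (restrict (\<lambda>x. x) (subtree T u))"
proof -
  obtain \<phi> where \<phi>: "MorT u u \<phi>" using Mor_nonempty[OF assms assms] assms unfolding MorT_def by blast
  let ?i = "\<lambda>y\<in>subtree T u. inv_into (subtree T u) \<phi> y"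
  have "compose (subtree T u) ?i \<phi> = restrict (\<lambda>x. x) (subtree T u)"
    unfolding compose_def by (rule restrict_ext) (rule MorT_inv_eq'[OF \<phi>])
  then show ?thesis using MorT_comp[OF \<phi> MorT_inv[OF \<phi>]] by simp
qed

text \<open>Take m, then \<phi>, then the inverse of m'. \<open>MorT_push\<close> is the same
  transport in the opposite direction.\<close>

lemma MorT_pull:
  assumes m: "MorT u v m" and m': "MorT x y m'" and \<phi>: "MorT v y \<phi>"
  shows "\<exists>g. MorT u x g \<and> (\<forall>z\<in>subtree T u. m' (g z) = \<phi> (m z))"
proof -
  let ?i = "\<lambda>z\<in>subtree T y. inv_into (subtree T x) m' z"
  have "MorT u x (compose (subtree T u) ?i (compose (subtree T u) \<phi> m))"
    by (rule MorT_comp[OF MorT_comp[OF m \<phi>] MorT_inv[OF m']])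
  moreover have "m' (compose (subtree T u) ?i (compose (subtree T u) \<phi> m) z) = \<phi> (m z)"
    if "z \<in> subtree T u" for z
    using MorT_inv_eq[OF m' MorT_in[OF \<phi> MorT_in[OF m that]]] that by (simp only: compose_eq)
  ultimately show ?thesis by blast
qed

lemma MorT_push:
  assumes m: "MorT u v m" and m': "MorT x y m'" and g: "MorT u x g"
  shows "\<exists>\<phi>. MorT v y \<phi> \<and> (\<forall>z\<in>subtree T u. \<phi> (m z) = m' (g z))"
proof -
  let ?i = "\<lambda>z\<in>subtree T v. inv_into (subtree T u) m z"
  have "MorT v y (compose (subtree T v) m' (compose (subtree T v) g ?i))"
    by (rule MorT_comp[OF MorT_comp[OF MorT_inv[OF m] g] m'])
  moreover have "compose (subtree T v) m' (compose (subtree T v) g ?i) (m z) = m' (g z)"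
    if "z \<in> subtree T u" for z
    using MorT_inv_eq'[OF m that] MorT_in[OF m that] by (simp only: compose_eq)
  ultimately show ?thesis by blast
qed

text \<open>The root represents its own type, so that words starting in type \<open>tp []\<close>
  are exactly as long as the vertices they name.\<close>

definition rep :: "'k \<Rightarrow> nat list" where
  "rep t = (if t = tp [] then [] else SOME u. u \<in> T \<and> tp u = t)"

definition children :: "'k \<Rightarrow> nat set" where
  "children t = {i. rep t @ [i] \<in> T}"

definition child_type :: "'k \<Rightarrow> nat \<Rightarrow> 'k" where
  "child_type t i = tp (rep t @ [i])"

lemma rep: assumes "t \<in> tp ` T" shows rep_T: "rep t \<in> T" and tp_rep: "tp (rep t) = t"
proof -
  have "rep t \<in> T \<and> tp (rep t) = t"
  proof (cases "t = tp []")
    case True then show ?thesis by (simp add: rep_def root_T)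
  next
    case False
    have "\<exists>u. u \<in> T \<and> tp u = t" using assms by auto
    then show ?thesis unfolding rep_def using False someI_ex[of "\<lambda>u. u \<in> T \<and> tp u = t"] by simp
  qed
  then show "rep t \<in> T" "tp (rep t) = t" by blast+
qed

sublocale automaton "tp ` T" children child_type
proof
  show "finite (tp ` T)" by (rule finite_types)
  show "finite (children t)" if "t \<in> tp ` T" for t
    unfolding children_def by (rule finite_children[OF rep_T[OF that]])
  show "children t \<noteq> {}" if "t \<in> tp ` T" for t
    using no_dead_ends rep_T[OF that] unfolding children_def no_dead_ends_def by blast
  show "child_type t i \<in> tp ` T" if "i \<in> children t" for t i
    using that unfolding children_def child_type_def by blast
qed

lemma child:
  assumes "i \<in> children t"
  shows "rep t @ [i] \<in> T" "tp (rep t @ [i]) = child_type t i" "child_type t i \<in> tp ` T"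
  using assms unfolding children_def child_type_def by blast+

definition child_morph :: "nat list \<Rightarrow> nat list \<Rightarrow> nat list" where
  "child_morph u = (SOME \<phi>. MorT (rep (tp u)) u \<phi>)"

text \<open>The chosen morphisms composed along a word: \<open>M t a\<close> carries the subtree of
  \<open>rep (dl t a)\<close> onto that of \<open>vert t a\<close>. Coherence under concatenation
  (\<open>M_append\<close>) is built in.\<close>

fun M :: "'k \<Rightarrow> nat list \<Rightarrow> nat list \<Rightarrow> nat list" where
  "M t [] = (\<lambda>x. x)"
| "M t (i # a) = (\<lambda>x. child_morph (rep t @ [i]) (M (child_type t i) a x))"

definition vert :: "'k \<Rightarrow> nat list \<Rightarrow> nat list" where
  "vert t a = M t a (rep (dl t a))"

lemma child_morph: "u \<in> T \<Longrightarrow> MorT (rep (tp u)) u (child_morph u)"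
  unfolding child_morph_def using Mor_nonempty[of "rep (tp u)" u]
  by (intro someI_ex[of "MorT (rep (tp u)) u"]) (auto simp: MorT_def rep_T tp_rep)

lemma M_append: "M t (a @ b) x = M t a (M (dl t a) b x)"
  by (induction a arbitrary: t) auto

lemma vert_append: "vert t (a @ b) = M t a (vert (dl t a) b)"
  by (simp add: vert_def M_append)

lemma vert_Nil [simp]: "vert t [] = rep t"
  by (simp add: vert_def)

lemma vert_Cons: "vert t (i # a) = child_morph (rep t @ [i]) (vert (child_type t i) a)"
  by (simp add: vert_def)

lemma subtreeE: assumes "x \<in> subtree T u" obtains z where "x = u @ z"
  using assms by (auto simp: subtree_def)

lemma M_MorT:
  assumes "t \<in> tp ` T" "word t a"
  shows "vert t a \<in> subtree T (rep t) \<and> tp (vert t a) = dl t a \<and>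
    length (vert t a) = length (rep t) + length a \<and>
    MorT (rep (dl t a)) (vert t a) (restrict (M t a) (subtree T (rep (dl t a))))"
  using assms
proof (induction a arbitrary: t)
  case Nil
  then show ?case using MorT_id[OF rep_T[OF Nil(1)]] subtree_self[OF rep_T[OF Nil(1)]] tp_rep[OF Nil(1)]
    by (simp only: M.simps vert_Nil foldl.simps list.size add_0_right simp_thms)
next
  case (Cons i a)
  let ?s = "child_type t i" let ?u = "rep t @ [i]" let ?r = "dl (child_type t i) a"
  have i: "i \<in> children t" and u: "?u \<in> T" "tp ?u = ?s" "?s \<in> tp ` T" "word ?s a"
    using Cons.prems child[of i t] by simp_all
  have k: "MorT (rep ?s) ?u (child_morph ?u)" using child_morph[OF u(1)] u(2) by simp
  have IH: "vert ?s a \<in> subtree T (rep ?s)" "tp (vert ?s a) = ?r"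
     "length (vert ?s a) = length (rep ?s) + length a"
     "MorT (rep ?r) (vert ?s a) (restrict (M ?s a) (subtree T (rep ?r)))"
    using Cons.IH[OF u(3,4)] by blast+
  obtain z where z1: "vert ?s a = rep ?s @ z" by (rule subtreeE[OF IH(1)])
  have z: "vert ?s a = rep ?s @ z" "length z = length a" using z1 IH(3) by simp_all
  have "\<exists>z'. child_morph ?u (rep ?s @ z) = child_morph ?u (rep ?s) @ z' \<and> length z' = length z"
    using MorT_append[OF k subtree_self[OF rep_T[OF u(3)]], of z] z(1) subtree_T[OF IH(1)] by simp
  then obtain z' where z': "vert t (i # a) = rep t @ i # z'" "length z' = length a"
    using z MorT_root[OF k] by (auto simp: vert_Cons)
  have inT: "vert t (i # a) \<in> T"
    using subtree_T[OF MorT_in[OF k IH(1)]] by (simp add: vert_Cons)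
  have 1: "vert t (i # a) \<in> subtree T (rep t)" using z'(1) inT by (auto simp: subtree_def)
  have 2: "tp (vert t (i # a)) = dl t (i # a)" using MorT_tp[OF k IH(1)] IH(2) by (simp add: vert_Cons)
  have 3: "length (vert t (i # a)) = length (rep t) + length (i # a)" using z' by simp
  have "MorT (rep ?r) (child_morph ?u (vert ?s a)) (compose (subtree T (rep ?r))
      (restrict (child_morph ?u) (subtree T (vert ?s a))) (restrict (M ?s a) (subtree T (rep ?r))))"
    by (rule MorT_comp[OF IH(4) MorT_restr[OF k IH(1)]])
  moreover have "compose (subtree T (rep ?r)) (restrict (child_morph ?u) (subtree T (vert ?s a)))
      (restrict (M ?s a) (subtree T (rep ?r))) = restrict (M t (i # a)) (subtree T (rep ?r))"
    unfolding compose_def using MorT_in[OF IH(4)] by (intro restrict_ext) simp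
  ultimately have "MorT (rep (dl t (i # a))) (vert t (i # a))
      (restrict (M t (i # a)) (subtree T (rep (dl t (i # a)))))"
    by (simp only: vert_Cons foldl.simps)
  then show ?case using 1 2 3 by blast
qed

lemma vert_subtree: "t \<in> tp ` T \<Longrightarrow> word t a \<Longrightarrow> vert t a \<in> subtree T (rep t)"
  and tp_vert: "t \<in> tp ` T \<Longrightarrow> word t a \<Longrightarrow> tp (vert t a) = dl t a"
  and length_vert: "t \<in> tp ` T \<Longrightarrow> word t a \<Longrightarrow> length (vert t a) = length (rep t) + length a"
  and MorT_M: "t \<in> tp ` T \<Longrightarrow> word t a \<Longrightarrow>
    MorT (rep (dl t a)) (vert t a) (restrict (M t a) (subtree T (rep (dl t a))))"
  using M_MorT by blast+

lemma vert_prefix: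
  assumes "t \<in> tp ` T" "word t (a @ b)"
  shows "\<exists>z. vert t (a @ b) = vert t a @ z \<and> length z = length b"
proof -
  let ?s = "dl t a"
  have a: "word t a" "word ?s b" "?s \<in> tp ` T" using assms dl_closed by auto
  have m: "MorT (rep ?s) (vert t a) (restrict (M t a) (subtree T (rep ?s)))" by (rule MorT_M[OF assms(1) a(1)])
  have v: "vert ?s b \<in> subtree T (rep ?s)" by (rule vert_subtree[OF a(3,2)])
  obtain z where z: "vert ?s b = rep ?s @ z" using subtreeE[OF v] by blast
  have "\<exists>z'. restrict (M t a) (subtree T (rep ?s)) (rep ?s @ z) = vert t a @ z' \<and> length z' = length z"
    using MorT_append[OF m subtree_self[OF rep_T[OF a(3)]], of z] MorT_root[OF m] z subtree_T[OF v] by simp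
  moreover have "length z = length b" using length_vert[OF a(3,2)] z by simp
  ultimately show ?thesis using v z by (simp add: vert_append)
qed

lemma vert_take:
  assumes "t \<in> tp ` T" "word t a" "n \<le> length a"
  shows "take (length (rep t) + n) (vert t a) = vert t (take n a)"
proof -
  obtain z where "vert t a = vert t (take n a) @ z"
    using vert_prefix[of t "take n a" "drop n a"] assms by auto
  then show ?thesis using length_vert[OF assms(1) word_take[OF assms(2)], of n] assms(3) by simp
qed

text \<open>Truncation to level one recovers the first letter; then the injective
  \<open>child_morph\<close> cancels.\<close>

lemma vert_inject:
  assumes "t \<in> tp ` T" "word t a" "word t b" "vert t a = vert t b"
  shows "a = b"
  using assms
proof (induction a arbitrary: t b)
  case Nil
  then show ?case using length_vert[of t b] by simp
next
  case (Cons i a)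
  have "length b = length (i # a)"
    using length_vert[OF Cons.prems(1,2)] length_vert[OF Cons.prems(1,3)] Cons.prems(4) by simp
  then obtain j b' where b: "b = j # b'" by (cases b) auto
  have "vert t [i] = vert t [j]"
    using vert_take[OF Cons.prems(1,2), of 1] vert_take[OF Cons.prems(1,3), of 1] Cons.prems(4) by (simp add: b)
  moreover have v1: "vert t [k] = rep t @ [k]" if "k \<in> children t" for k
  proof -
    have "rep t @ [k] \<in> T" using that by (simp add: children_def)
    then show ?thesis using MorT_root[OF child_morph] by (simp add: vert_Cons child_type_def)
  qed
  ultimately have ij: "j = i" using Cons.prems(2,3) b by simp
  let ?u = "rep t @ [i]" let ?s = "child_type t i"
  have u: "?u \<in> T" "tp ?u = ?s" "?s \<in> tp ` T" "word ?s a" "word ?s b'"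
    using Cons.prems b ij child[of i t] by simp_all
  have k: "MorT (rep ?s) ?u (child_morph ?u)" using child_morph[OF u(1)] u(2) by simp
  have "child_morph ?u (vert ?s a) = child_morph ?u (vert ?s b')" using Cons.prems(4) b ij by (simp add: vert_Cons)
  then have "vert ?s a = vert ?s b'"
    using bij_betw_imp_inj_on[OF MorT_bij[OF k]] vert_subtree u(3-5) unfolding inj_on_def by blast
  then show ?case using Cons.IH[OF u(3-5)] b ij by simp
qed

text \<open>The induction is on the length of z and not on z itself: pulling back along
  \<open>child_morph\<close> keeps levels but changes letters.\<close>

lemma vert_surj:
  assumes "t \<in> tp ` T" "u \<in> subtree T (rep t)"
  shows "\<exists>a. word t a \<and> vert t a = u"
proof -
  obtain z where "u = rep t @ z" using subtreeE[OF assms(2)] .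
  then show ?thesis using assms
  proof (induction "length z" arbitrary: t u z)
    case 0
    then show ?case by (intro exI[of _ "[]"]) simp
  next
    case (Suc n)
    then obtain i y where z: "z = i # y" by (cases z) auto
    let ?u = "rep t @ [i]" let ?s = "child_type t i"
    have uT: "?u @ y \<in> T" using Suc.prems z subtree_T by simp
    have u: "?u \<in> T" "tp ?u = ?s" "?s \<in> tp ` T"
      using T_prefix[OF uT] by (auto simp: child_type_def)
    have k: "MorT (rep ?s) ?u (child_morph ?u)" using child_morph[OF u(1)] u(2) by simp
    have "u \<in> subtree T ?u" using Suc.prems(1) z uT by (simp add: subtree_def)
    then have "u \<in> child_morph ?u ` subtree T (rep ?s)" by (simp only: bij_betw_imp_surj_on[OF MorT_bij[OF k]])
    then obtain x where x: "x \<in> subtree T (rep ?s)" "child_morph ?u x = u" by blast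
    obtain w where w: "x = rep ?s @ w" using subtreeE[OF x(1)] .
    have "rep ?s @ w \<in> T" using subtree_T[OF x(1)] w by simp
    then obtain w' where "child_morph ?u x = ?u @ w'" "length w' = length w"
      using MorT_append[OF k subtree_self[OF rep_T[OF u(3)]]] unfolding MorT_root[OF k] w by blast
    then have "n = length w" using Suc.prems(1) Suc.hyps(2) x(2) z by simp
    then obtain a where a: "word ?s a" "vert ?s a = x"
      using Suc.hyps(1)[OF _ w u(3) x(1)] by blast
    have "i \<in> children t" using u(1) by (simp add: children_def)
    then show ?case using a x(2) by (intro exI[of _ "i # a"]) (simp add: vert_Cons)
  qed
qed

section \<open>Morphisms acting on words\<close>

definition word_map :: "'k \<Rightarrow> (nat list \<Rightarrow> nat list) \<Rightarrow> nat list \<Rightarrow> nat list" where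
  "word_map t g a = (THE b. word t b \<and> vert t b = g (vert t a))"

definition limit_map :: "'k \<Rightarrow> (nat list \<Rightarrow> nat list) \<Rightarrow> (nat \<Rightarrow> nat) \<Rightarrow> nat \<Rightarrow> nat" where
  "limit_map t g = limit (word_map t g)"

text \<open>These twists are the whole difference between an arbitrary morphism and a plain exchange
  of prefixes, and each type has only finitely many.\<close>

definition \<Gamma> :: "'k \<Rightarrow> ((nat \<Rightarrow> nat) \<Rightarrow> nat \<Rightarrow> nat) set" where
  "\<Gamma> t = limit_map t ` {g. MorT (rep t) (rep t) g}"

lemma word_map:
  assumes t: "t \<in> tp ` T" and g: "MorT (rep t) (rep t) g" and a: "word t a"
  shows "word t (word_map t g a)" "vert t (word_map t g a) = g (vert t a)" "length (word_map t g a) = length a"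
proof -
  have gv: "g (vert t a) \<in> subtree T (rep t)" by (rule MorT_in[OF g vert_subtree[OF t a]])
  obtain b where b: "word t b" "vert t b = g (vert t a)" using vert_surj[OF t gv] by blast
  have "word_map t g a = b" unfolding word_map_def using b vert_inject[OF t] by (intro the_equality) auto
  then show 1: "word t (word_map t g a)" "vert t (word_map t g a) = g (vert t a)" using b by simp_all
  obtain z where z: "vert t a = rep t @ z" using subtreeE[OF vert_subtree[OF t a]] .
  then obtain z' where "g (vert t a) = rep t @ z'" "length z' = length z"
    using MorT_append[OF g subtree_self[OF rep_T[OF t]], of z] MorT_root[OF g] subtree_T[OF vert_subtree[OF t a]]
    by auto
  then show "length (word_map t g a) = length a"
    using length_vert[OF t 1(1)] length_vert[OF t a] 1(2) z by simp
qed

lemma word_map_eqI: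
  assumes "t \<in> tp ` T" "MorT (rep t) (rep t) g" "word t a" "word t b" "vert t b = g (vert t a)"
  shows "word_map t g a = b"
  using vert_inject[OF assms(1)] word_map[OF assms(1-3)] assms(4,5) by simp

lemma word_map_take:
  assumes t: "t \<in> tp ` T" and g: "MorT (rep t) (rep t) g" and a: "word t (a @ b)"
  shows "take (length a) (word_map t g (a @ b)) = word_map t g a"
proof (rule sym, rule word_map_eqI[OF t g])
  show wa: "word t a" using a by simp
  show "word t (take (length a) (word_map t g (a @ b)))" using word_take word_map(1)[OF t g a] by blast
  obtain z where z: "vert t (a @ b) = vert t a @ z" using vert_prefix[OF t a] by blast
  obtain z' where z': "g (vert t (a @ b)) = g (vert t a) @ z'"
    using MorT_append[OF g vert_subtree[OF t wa], of z] subtree_T[OF vert_subtree[OF t a]] z by auto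
  have "length (g (vert t a)) = length (rep t) + length a"
    using length_vert[OF t word_map(1)[OF t g wa]] word_map(2,3)[OF t g wa] by simp
  moreover have "vert t (take (length a) (word_map t g (a @ b))) = take (length (rep t) + length a) (vert t (word_map t g (a @ b)))"
    using vert_take[OF t word_map(1)[OF t g a], of "length a"] word_map(3)[OF t g a] by simp
  ultimately show "vert t (take (length a) (word_map t g (a @ b))) = g (vert t a)"
    using word_map(2)[OF t g a] z' by simp
qed

lemma pre_limit_map:
  assumes t: "t \<in> tp ` T" and g: "MorT (rep t) (rep t) g" and p: "p \<in> L t"
  shows "pre (limit_map t g p) n = word_map t g (pre p n)"
  unfolding limit_map_def
proof (rule pre_limit)
  show "length (word_map t g (pre p n)) = n" for n using word_map(3)[OF t g word_pre[OF p]] by simp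
  show "take n (word_map t g (pre p (Suc n))) = word_map t g (pre p n)" for n
    using word_map_take[OF t g, of "pre p n" "[p n]"] word_pre[OF p, of "Suc n"] by (simp add: pre_Suc)
qed

lemma vert_pre_limit_map:
  assumes t: "t \<in> tp ` T" and g: "MorT (rep t) (rep t) g" and p: "p \<in> L t"
  shows "vert t (pre (limit_map t g p) n) = g (vert t (pre p n))"
  using word_map(2)[OF t g word_pre[OF p]] pre_limit_map[OF t g p] by simp

lemma limit_map_L:
  assumes t: "t \<in> tp ` T" and g: "MorT (rep t) (rep t) g" and p: "p \<in> L t"
  shows "limit_map t g p \<in> L t"
  unfolding L_def using word_map(1)[OF t g word_pre[OF p]] pre_limit_map[OF t g p] by simp

lemma vert_ext:
  assumes t: "t \<in> tp ` T" and "p \<in> L t" "q \<in> L t" "\<And>n. vert t (pre p n) = vert t (pre q n)"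
  shows "p = q"
  using assms vert_inject[OF t] word_pre by (metis ext_pre)

lemma finite_\<Gamma>: "t \<in> tp ` T \<Longrightarrow> finite (\<Gamma> t)"
  unfolding \<Gamma>_def MorT_def using finite_Mor[of "rep t" "rep t"] rep_T by simp

lemma \<Gamma>_L: "t \<in> tp ` T \<Longrightarrow> k \<in> \<Gamma> t \<Longrightarrow> p \<in> L t \<Longrightarrow> k p \<in> L t"
  unfolding \<Gamma>_def using limit_map_L by auto

lemma \<Gamma>_id: assumes t: "t \<in> tp ` T" shows "\<exists>k\<in>\<Gamma> t. \<forall>p\<in>L t. k p = p"
proof -
  let ?g = "restrict (\<lambda>x. x) (subtree T (rep t))"
  have g: "MorT (rep t) (rep t) ?g" by (rule MorT_id[OF rep_T[OF t]])
  have "limit_map t ?g p = p" if p: "p \<in> L t" for p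
  proof (rule vert_ext[OF t limit_map_L[OF t g p] p])
    show "vert t (pre (limit_map t ?g p) n) = vert t (pre p n)" for n
      using vert_pre_limit_map[OF t g p] vert_subtree[OF t word_pre[OF p]] by simp
  qed
  then show ?thesis unfolding \<Gamma>_def using g by blast
qed

lemma \<Gamma>_surj: assumes t: "t \<in> tp ` T" and k: "k \<in> \<Gamma> t" shows "k ` L t = L t"
proof
  show "k ` L t \<subseteq> L t" using \<Gamma>_L[OF t k] by blast
  obtain g where g: "MorT (rep t) (rep t) g" "k = limit_map t g" using k by (auto simp: \<Gamma>_def)
  let ?i = "\<lambda>y\<in>subtree T (rep t). inv_into (subtree T (rep t)) g y"
  have i: "MorT (rep t) (rep t) ?i" by (rule MorT_inv[OF g(1)])
  show "L t \<subseteq> k ` L t"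
  proof
    fix p assume p: "p \<in> L t"
    have q: "limit_map t ?i p \<in> L t" by (rule limit_map_L[OF t i p])
    have "limit_map t g (limit_map t ?i p) = p"
    proof (rule vert_ext[OF t limit_map_L[OF t g(1) q] p])
      show "vert t (pre (limit_map t g (limit_map t ?i p)) n) = vert t (pre p n)" for n
        unfolding vert_pre_limit_map[OF t g(1) q] vert_pre_limit_map[OF t i p]
        by (rule MorT_inv_eq[OF g(1) vert_subtree[OF t word_pre[OF p]]])
    qed
    then show "p \<in> k ` L t" using q g(2) by (metis image_eqI)
  qed
qed

text \<open>Undoing \<open>M s a\<close> and \<open>M s b\<close> on the two sides of \<phi> leaves
  a morphism of the representative to itself. So \<phi> exchanges the prefixes a and b and twists
  the rest by g.\<close>

lemma Mor_to_\<Gamma>: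
  assumes s: "s \<in> tp ` T" and a: "word s a" "word s b" "dl s a = dl s b"
    and \<phi>: "MorT (vert s a) (vert s b) \<phi>"
  shows "\<exists>g. MorT (rep (dl s a)) (rep (dl s a)) g \<and>
    (\<forall>c. word (dl s a) c \<longrightarrow> \<phi> (vert s (a @ c)) = vert s (b @ word_map (dl s a) g c))"
proof -
  let ?t = "dl s a" let ?S = "subtree T (rep (dl s a))"
  have t: "?t \<in> tp ` T" by (rule dl_closed[OF s a(1)])
  have m: "MorT (rep ?t) (vert s a) (restrict (M s a) ?S)" by (rule MorT_M[OF s a(1)])
  have m': "MorT (rep ?t) (vert s b) (restrict (M s b) ?S)" using MorT_M[OF s a(2)] a(3) by simp
  obtain g where g: "MorT (rep ?t) (rep ?t) g"
    "\<And>z. z \<in> ?S \<Longrightarrow> restrict (M s b) ?S (g z) = \<phi> (restrict (M s a) ?S z)"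
    using MorT_pull[OF m m' \<phi>] by blast
  have "\<phi> (vert s (a @ c)) = vert s (b @ word_map ?t g c)" if c: "word ?t c" for c
    using g(2)[OF vert_subtree[OF t c]] vert_subtree[OF t c] MorT_in[OF g(1) vert_subtree[OF t c]]
      word_map(2)[OF t g(1) c] a(3) by (simp add: vert_append)
  then show ?thesis using g(1) by blast
qed

lemma \<Gamma>_to_Mor:
  assumes s: "s \<in> tp ` T" and a: "word s a" "word s b" "dl s a = dl s b"
    and g: "MorT (rep (dl s a)) (rep (dl s a)) g"
  shows "\<exists>\<phi>. MorT (vert s a) (vert s b) \<phi> \<and>
    (\<forall>c. word (dl s a) c \<longrightarrow> \<phi> (vert s (a @ c)) = vert s (b @ word_map (dl s a) g c))"
proof -
  let ?t = "dl s a" let ?S = "subtree T (rep (dl s a))"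
  have t: "?t \<in> tp ` T" by (rule dl_closed[OF s a(1)])
  have m: "MorT (rep ?t) (vert s a) (restrict (M s a) ?S)" by (rule MorT_M[OF s a(1)])
  have m': "MorT (rep ?t) (vert s b) (restrict (M s b) ?S)" using MorT_M[OF s a(2)] a(3) by simp
  obtain \<phi> where \<phi>: "MorT (vert s a) (vert s b) \<phi>"
    "\<And>z. z \<in> ?S \<Longrightarrow> \<phi> (restrict (M s a) ?S z) = restrict (M s b) ?S (g z)"
    using MorT_push[OF m m' g] by blast
  have "\<phi> (vert s (a @ c)) = vert s (b @ word_map ?t g c)" if c: "word ?t c" for c
    using \<phi>(2)[OF vert_subtree[OF t c]] vert_subtree[OF t c] MorT_in[OF g vert_subtree[OF t c]]
      word_map(2)[OF t g c] a(3) by (simp add: vert_append)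
  then show ?thesis using \<phi>(1) by blast
qed

text \<open>Closure of morphisms under restriction, in coordinates: below z the map replaces the
  prefix and acts by another twist. It lets a twist be moved past a prefix z.\<close>

lemma \<Gamma>_restrict:
  assumes s: "s \<in> tp ` T" and l: "l \<in> \<Gamma> s" and z: "word s z"
  obtains z' l' where "word s z'" "dl s z' = dl s z" "l' \<in> \<Gamma> (dl s z)"
    "\<And>p. p \<in> L (dl s z) \<Longrightarrow> l (conc z p) = conc z' (l' p)"
proof -
  obtain g where g: "MorT (rep s) (rep s) g" "l = limit_map s g" using l by (auto simp: \<Gamma>_def)
  let ?z' = "word_map s g z" let ?t = "dl s z"
  have t: "?t \<in> tp ` T" by (rule dl_closed[OF s z])
  have z': "word s ?z'" "vert s ?z' = g (vert s z)" using word_map[OF s g(1) z] by blast+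
  have vz: "vert s z \<in> subtree T (rep s)" by (rule vert_subtree[OF s z])
  have dz: "dl s z = dl s ?z'"
    using MorT_tp[OF g(1) vz] tp_vert[OF s z] tp_vert[OF s z'(1)] z'(2) by simp
  have "MorT (vert s z) (vert s ?z') (restrict g (subtree T (vert s z)))"
    unfolding z'(2) by (rule MorT_restr[OF g(1) vz])
  then obtain h where h: "MorT (rep ?t) (rep ?t) h"
    "\<And>c. word ?t c \<Longrightarrow> restrict g (subtree T (vert s z)) (vert s (z @ c)) = vert s (?z' @ word_map ?t h c)"
    using Mor_to_\<Gamma>[OF s z z'(1) dz] by blast
  have "l (conc z p) = conc ?z' (limit_map ?t h p)" if p: "p \<in> L ?t" for p
  proof -
    have zp: "conc z p \<in> L s" using p z by simp
    have "pre (limit_map s g (conc z p)) (length z + n) = pre (conc ?z' (limit_map ?t h p)) (length z + n)" for n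
    proof -
      have w: "word s (z @ pre p n)" using z word_pre[OF p] by simp
      have "vert s (z @ pre p n) \<in> subtree T (vert s z)"
        using vert_prefix[OF s w] subtree_T[OF vert_subtree[OF s w]] by (auto simp: subtree_def)
      then have "g (vert s (z @ pre p n)) = vert s (?z' @ word_map ?t h (pre p n))"
        using h(2)[OF word_pre[OF p], of n] by simp
      moreover have "word s (?z' @ word_map ?t h (pre p n))"
        using z'(1) word_map(1)[OF t h(1) word_pre[OF p]] dz by simp
      ultimately have "word_map s g (z @ pre p n) = ?z' @ word_map ?t h (pre p n)"
        by (intro word_map_eqI[OF s g(1) w]) simp_all
      moreover have "pre (conc ?z' (limit_map ?t h p)) (length z + n) = ?z' @ pre (limit_map ?t h p) n"
        using pre_conc_add[of ?z' "limit_map ?t h p" n] word_map(3)[OF s g(1) z] by simp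
      ultimately show ?thesis using pre_limit_map[OF s g(1) zp] pre_limit_map[OF t h(1) p] by (simp add: pre_conc_add)
    qed
    then have "pre (limit_map s g (conc z p)) n = pre (conc ?z' (limit_map ?t h p)) n" for n
      using pre_eq_mono le_add2 by metis
    then show ?thesis unfolding g(2) by (rule ext_pre)
  qed
  moreover have "limit_map ?t h \<in> \<Gamma> ?t" unfolding \<Gamma>_def using h(1) by blast
  ultimately show thesis using that z'(1) dz by metis
qed

end

section \<open>The boundary in word coordinates\<close>

context self_similar_tree
begin

abbreviation t0 :: 'k where
  "t0 \<equiv> tp []"

definition bdry_of :: "(nat \<Rightarrow> nat) \<Rightarrow> nat \<Rightarrow> nat" where
  "bdry_of = limit (vert t0)"

definition coord :: "(nat \<Rightarrow> nat) \<Rightarrow> nat \<Rightarrow> nat" where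
  "coord = inv_into (L t0) bdry_of"

definition conjugate :: "((nat \<Rightarrow> nat) \<Rightarrow> nat \<Rightarrow> nat) \<Rightarrow> (nat \<Rightarrow> nat) \<Rightarrow> nat \<Rightarrow> nat" where
  "conjugate f p = coord (f (bdry_of p))"

lemma t0: "t0 \<in> tp ` T"
  using root_T by blast

lemma rep_t0: "rep t0 = []"
  by (simp add: rep_def)

lemma length_vert0: "word t0 a \<Longrightarrow> length (vert t0 a) = length a"
  using length_vert[OF t0] by (simp add: rep_t0)

lemma vert_T: "word t0 a \<Longrightarrow> vert t0 a \<in> T"
  using vert_subtree[OF t0] by (simp add: rep_t0 subtree_root)

lemma vert0_surj: "u \<in> T \<Longrightarrow> \<exists>a. word t0 a \<and> vert t0 a = u"
  using vert_surj[OF t0] by (simp add: rep_t0 subtree_root)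

lemma vert0_take: "word t0 a \<Longrightarrow> n \<le> length a \<Longrightarrow> take n (vert t0 a) = vert t0 (take n a)"
  using vert_take[OF t0, of a n] by (simp add: rep_t0)

lemma pre_bdry_of: "p \<in> L t0 \<Longrightarrow> pre (bdry_of p) n = vert t0 (pre p n)"
  unfolding bdry_of_def
proof (rule pre_limit)
  assume p: "p \<in> L t0"
  show "length (vert t0 (pre p n)) = n" for n using length_vert0[OF word_pre[OF p]] by simp
  show "take n (vert t0 (pre p (Suc n))) = vert t0 (pre p n)" for n
    using vert0_take[OF word_pre[OF p], of n "Suc n"] by (simp add: take_pre)
qed

lemma bdry_of_bdry: "p \<in> L t0 \<Longrightarrow> bdry_of p \<in> bdry T"
  unfolding bdry_def using pre_bdry_of vert_T word_pre by simp

lemma bdry_of_pre_eq_iff: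
  "p \<in> L t0 \<Longrightarrow> p' \<in> L t0 \<Longrightarrow> pre (bdry_of p) n = pre (bdry_of p') n \<longleftrightarrow> pre p n = pre p' n"
  using vert_inject[OF t0] word_pre by (auto simp: pre_bdry_of)

lemma inj_bdry_of: "inj_on bdry_of (L t0)"
  by (rule inj_onI) (metis bdry_of_pre_eq_iff ext_pre)

lemma bdry_of_image: "bdry_of ` L t0 = bdry T"
proof
  show "bdry_of ` L t0 \<subseteq> bdry T" using bdry_of_bdry by blast
  show "bdry T \<subseteq> bdry_of ` L t0"
  proof
    fix b assume b: "b \<in> bdry T"
    define addr where "addr u = (SOME a. word t0 a \<and> vert t0 a = u)" for u
    have addr: "word t0 (addr (pre b n)) \<and> vert t0 (addr (pre b n)) = pre b n" for n
    proof -
      have "pre b n \<in> T" using b by (simp add: bdry_def)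
      then show ?thesis unfolding addr_def using someI_ex[OF vert0_surj] by blast
    qed
    have len: "length (addr (pre b n)) = n" for n
      using length_vert0[of "addr (pre b n)"] addr[of n] by simp
    define p where "p = limit addr b"
    have prep: "pre p n = addr (pre b n)" for n
      unfolding p_def
    proof (rule pre_limit)
      show "length (addr (pre b n)) = n" for n by (rule len)
      show "take n (addr (pre b (Suc n))) = addr (pre b n)" for n
      proof (rule vert_inject[OF t0])
        show "word t0 (take n (addr (pre b (Suc n))))" "word t0 (addr (pre b n))"
          using addr word_take by blast+
        show "vert t0 (take n (addr (pre b (Suc n)))) = vert t0 (addr (pre b n))"
        proof -
          have "vert t0 (take n (addr (pre b (Suc n)))) = take n (vert t0 (addr (pre b (Suc n))))"
            by (rule vert0_take[symmetric]) (use addr len in auto)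
          also have "\<dots> = vert t0 (addr (pre b n))" using addr by (simp add: take_pre)
          finally show ?thesis .
        qed
      qed
    qed
    have p: "p \<in> L t0" unfolding L_def using prep addr by simp
    have "pre (bdry_of p) n = pre b n" for n using pre_bdry_of[OF p] prep addr by simp
    then have "bdry_of p = b" by (rule ext_pre)
    then show "b \<in> bdry_of ` L t0" using p by blast
  qed
qed

lemma coord_bdry_of [simp]: "p \<in> L t0 \<Longrightarrow> coord (bdry_of p) = p"
  unfolding coord_def by (rule inv_into_f_f[OF inj_bdry_of])

lemma bdry_of_coord [simp]: "b \<in> bdry T \<Longrightarrow> bdry_of (coord b) = b"
  unfolding coord_def using f_inv_into_f[of b bdry_of "L t0"] by (simp add: bdry_of_image)

lemma coord_L: "b \<in> bdry T \<Longrightarrow> coord b \<in> L t0"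
  unfolding coord_def using inv_into_into[of b bdry_of "L t0"] by (simp add: bdry_of_image)

lemma continuous_on_bdry_of: "continuous_on (L t0) bdry_of"
  unfolding continuous_on_pre_iff using bdry_of_pre_eq_iff by blast

lemma continuous_on_coord: "continuous_on (bdry T) coord"
  unfolding continuous_on_pre_iff
proof (intro ballI allI)
  fix b n assume b: "b \<in> bdry T"
  have "pre (coord b') n = pre (coord b) n" if "b' \<in> bdry T" "pre b' n = pre b n" for b'
    using bdry_of_pre_eq_iff[OF coord_L[OF that(1)] coord_L[OF b], of n] that b by simp
  then show "\<exists>m. \<forall>b'\<in>bdry T. pre b' m = pre b m \<longrightarrow> pre (coord b') n = pre (coord b) n" by blast
qed

lemma homeomorphism_bdry_of: "homeomorphism (L t0) (bdry T) bdry_of coord"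
  by (rule homeomorphismI)
    (auto simp: continuous_on_bdry_of continuous_on_coord bdry_of_bdry coord_L)

lemma homeomorphism_conjugate:
  assumes "homeomorphism (bdry T) (bdry T) f g"
  shows "homeomorphism (L t0) (L t0) (conjugate f) (conjugate g)"
proof -
  have "homeomorphism (L t0) (L t0) (coord \<circ> (f \<circ> bdry_of)) ((coord \<circ> g) \<circ> bdry_of)"
    by (intro homeomorphism_compose[OF homeomorphism_compose[OF homeomorphism_bdry_of assms]]
        homeomorphism_symD[OF homeomorphism_bdry_of])
  moreover have "coord \<circ> (f \<circ> bdry_of) = conjugate f" "(coord \<circ> g) \<circ> bdry_of = conjugate g" by (auto simp: conjugate_def)
  ultimately show ?thesis by simp
qed

lemma bdry_of_conjugate: "f (bdry_of p) \<in> bdry T \<Longrightarrow> bdry_of (conjugate f p) = f (bdry_of p)"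
  by (simp add: conjugate_def)

lemma cyl_vert:
  assumes a: "word t0 a" shows "cyl T (vert t0 a) = bdry_of ` conc a ` L (dl t0 a)"
proof
  show "cyl T (vert t0 a) \<subseteq> bdry_of ` conc a ` L (dl t0 a)"
  proof
    fix b assume "b \<in> cyl T (vert t0 a)"
    then have b: "b \<in> bdry T" "pre b (length a) = vert t0 a"
      by (simp_all add: cyl_def length_vert0[OF a])
    have c: "coord b \<in> L t0" by (rule coord_L[OF b(1)])
    have "vert t0 (pre (coord b) (length a)) = vert t0 a" using pre_bdry_of[OF c, of "length a"] b by simp
    then have "pre (coord b) (length a) = a" using vert_inject[OF t0 word_pre[OF c] a] by blast
    then have e: "coord b = conc a (sdrop (length a) (coord b))" by (rule pre_eq_conc)
    then have "sdrop (length a) (coord b) \<in> L (dl t0 a)" using c L_conc by metis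
    then show "b \<in> bdry_of ` conc a ` L (dl t0 a)" using e bdry_of_coord[OF b(1)] by (metis image_eqI)
  qed
  show "bdry_of ` conc a ` L (dl t0 a) \<subseteq> cyl T (vert t0 a)"
    using a by (auto simp: cyl_def length_vert0 bdry_of_bdry pre_bdry_of)
qed

lemma induced_bdry_of:
  assumes a: "word t0 a" "word t0 b" "dl t0 a = dl t0 b"
    and g: "MorT (rep (dl t0 a)) (rep (dl t0 a)) g"
    and \<phi>: "\<And>c. word (dl t0 a) c \<Longrightarrow> \<phi> (vert t0 (a @ c)) = vert t0 (b @ word_map (dl t0 a) g c)"
    and p: "p \<in> L (dl t0 a)"
  shows "induced (vert t0 a) \<phi> (bdry_of (conc a p)) = bdry_of (conc b (limit_map (dl t0 a) g p))"
proof
  fix n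
  let ?t = "dl t0 a"
  have t: "?t \<in> tp ` T" by (rule dl_closed[OF t0 a(1)])
  have bp: "limit_map ?t g p \<in> L ?t" by (rule limit_map_L[OF t g p])
  have ap: "conc a p \<in> L t0" "conc b (limit_map ?t g p) \<in> L t0" using a p bp by simp_all
  \<comment> \<open>The extra \<open>length a\<close> letters put the prefix below
    \<open>vert t0 a\<close>, where \<phi> is under control; its image still has more than n
    letters.\<close>
  have "\<phi> (pre (bdry_of (conc a p)) (Suc n + length a)) = \<phi> (vert t0 (a @ pre p (Suc n)))"
    using pre_bdry_of[OF ap(1)] pre_conc_add[of a p "Suc n"] by (simp add: add.commute)
  also have "\<dots> = vert t0 (b @ pre (limit_map ?t g p) (Suc n))"
    using \<phi>[OF word_pre[OF p]] pre_limit_map[OF t g p] by simp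
  also have "\<dots> = pre (bdry_of (conc b (limit_map ?t g p))) (length b + Suc n)"
    unfolding pre_bdry_of[OF ap(2)] pre_conc_add ..
  finally show "induced (vert t0 a) \<phi> (bdry_of (conc a p)) n = bdry_of (conc b (limit_map ?t g p)) n"
    by (simp add: induced_def length_vert0[OF a(1)])
qed

section \<open>Rationality as finiteness of local actions\<close>

definition word_equiv :: "((nat \<Rightarrow> nat) \<Rightarrow> nat \<Rightarrow> nat) \<Rightarrow> nat list \<Rightarrow> nat list \<Rightarrow> bool" where
  "word_equiv F a b \<longleftrightarrow> dl t0 a = dl t0 b \<and> (\<exists>c e. word t0 c \<and> word t0 e \<and> dl t0 c = dl t0 e \<and>
     (\<exists>k\<in>\<Gamma> (dl t0 a). \<exists>l\<in>\<Gamma> (dl t0 c). \<forall>p\<in>L (dl t0 a). \<exists>p'\<in>L (dl t0 c).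
        F (conc a p) = conc c p' \<and> F (conc b (k p)) = conc e (l p')))"

text \<open>The two morphisms become the twists k and l. That f maps the second cylinder into the
  one of y is recovered from surjectivity of k (\<open>\<Gamma>_surj\<close>).\<close>

lemma equiv_restr_word_equiv:
  assumes f: "f ` bdry T \<subseteq> bdry T" and a: "word t0 a" and b: "word t0 b"
  shows "equiv_restr T tp Mor f (vert t0 a) (vert t0 b) \<longleftrightarrow> word_equiv (conjugate f) a b"
proof
  let ?v = "vert t0 a" let ?w = "vert t0 b" let ?t = "dl t0 a"
  assume "equiv_restr T tp Mor f ?v ?w"
  then obtain x y \<phi> \<psi> where e: "tp ?v = tp ?w" "x \<in> T" "y \<in> T" "tp x = tp y"
    "\<phi> \<in> Mor ?v ?w" "\<psi> \<in> Mor x y" "f ` cyl T ?v \<subseteq> cyl T x"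
    "\<forall>p\<in>cyl T ?v. f (induced ?v \<phi> p) = induced x \<psi> (f p)"
    unfolding equiv_restr_def by (elim conjE bexE) (rule that, assumption+)
  have ab: "?t = dl t0 b" using e(1) tp_vert[OF t0] a b by simp
  obtain c where c: "word t0 c" "vert t0 c = x" using vert0_surj[OF e(2)] by blast
  obtain d where d: "word t0 d" "vert t0 d = y" using vert0_surj[OF e(3)] by blast
  have cd: "dl t0 c = dl t0 d" using e(4) tp_vert[OF t0] c d by metis
  let ?s = "dl t0 c"
  have \<phi>: "MorT ?v ?w \<phi>" using e(1,5) vert_T a b by (simp add: MorT_def)
  have \<psi>: "MorT (vert t0 c) (vert t0 d) \<psi>" using e(2-4,6) c d by (simp add: MorT_def)
  obtain g where g: "MorT (rep ?t) (rep ?t) g"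
      "\<And>z. word ?t z \<Longrightarrow> \<phi> (vert t0 (a @ z)) = vert t0 (b @ word_map ?t g z)"
    using Mor_to_\<Gamma>[OF t0 a b ab \<phi>] by blast
  obtain h where h: "MorT (rep ?s) (rep ?s) h"
      "\<And>z. word ?s z \<Longrightarrow> \<psi> (vert t0 (c @ z)) = vert t0 (d @ word_map ?s h z)"
    using Mor_to_\<Gamma>[OF t0 c(1) d(1) cd \<psi>] by blast
  have t: "?t \<in> tp ` T" by (rule dl_closed[OF t0 a])
  have s: "?s \<in> tp ` T" by (rule dl_closed[OF t0 c(1)])
  have "\<exists>p'\<in>L ?s. conjugate f (conc a p) = conc c p' \<and> conjugate f (conc b (limit_map ?t g p)) = conc d (limit_map ?s h p')"
    if p: "p \<in> L ?t" for p
  proof -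
    have pc: "bdry_of (conc a p) \<in> cyl T ?v" using cyl_vert[OF a] p by blast
    then have "f (bdry_of (conc a p)) \<in> cyl T (vert t0 c)" using e(7) c(2) by blast
    then obtain p' where p': "p' \<in> L ?s" "f (bdry_of (conc a p)) = bdry_of (conc c p')"
      using cyl_vert[OF c(1)] by blast
    have "f (bdry_of (conc b (limit_map ?t g p))) = f (induced ?v \<phi> (bdry_of (conc a p)))"
      using induced_bdry_of[OF a b ab g p] by simp
    also have "\<dots> = induced x \<psi> (f (bdry_of (conc a p)))" using e(8) pc by blast
    also have "\<dots> = bdry_of (conc d (limit_map ?s h p'))"
      using induced_bdry_of[OF c(1) d(1) cd h p'(1)] c(2) p'(2) by simp
    finally have q: "f (bdry_of (conc b (limit_map ?t g p))) = bdry_of (conc d (limit_map ?s h p'))" .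
    have "conc c p' \<in> L t0" "conc d (limit_map ?s h p') \<in> L t0"
      using p'(1) c(1) d(1) cd limit_map_L[OF s h(1) p'(1)] by simp_all
    then have "conjugate f (conc a p) = conc c p'" "conjugate f (conc b (limit_map ?t g p)) = conc d (limit_map ?s h p')"
      using p'(2) q by (simp_all add: conjugate_def)
    then show ?thesis using p'(1) by blast
  qed
  moreover have "limit_map ?t g \<in> \<Gamma> ?t" "limit_map ?s h \<in> \<Gamma> ?s" unfolding \<Gamma>_def using g(1) h(1) by blast+
  ultimately show "word_equiv (conjugate f) a b" unfolding word_equiv_def using ab c(1) d(1) cd by blast
next
  let ?v = "vert t0 a" let ?w = "vert t0 b" let ?t = "dl t0 a"
  assume "word_equiv (conjugate f) a b"
  then obtain c d k l where w: "?t = dl t0 b" "word t0 c" "word t0 d" "dl t0 c = dl t0 d"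
    "k \<in> \<Gamma> ?t" "l \<in> \<Gamma> (dl t0 c)"
    "\<And>p. p \<in> L ?t \<Longrightarrow> \<exists>p'\<in>L (dl t0 c). conjugate f (conc a p) = conc c p' \<and> conjugate f (conc b (k p)) = conc d (l p')"
    unfolding word_equiv_def by blast
  let ?s = "dl t0 c" let ?x = "vert t0 c" let ?y = "vert t0 d"
  have t: "?t \<in> tp ` T" by (rule dl_closed[OF t0 a])
  have s: "?s \<in> tp ` T" by (rule dl_closed[OF t0 w(2)])
  obtain g where g: "MorT (rep ?t) (rep ?t) g" "k = limit_map ?t g" using w(5) by (auto simp: \<Gamma>_def)
  obtain h where h: "MorT (rep ?s) (rep ?s) h" "l = limit_map ?s h" using w(6) by (auto simp: \<Gamma>_def)
  obtain \<phi> where \<phi>: "MorT ?v ?w \<phi>"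
      "\<And>z. word ?t z \<Longrightarrow> \<phi> (vert t0 (a @ z)) = vert t0 (b @ word_map ?t g z)"
    using \<Gamma>_to_Mor[OF t0 a b w(1) g(1)] by blast
  obtain \<psi> where \<psi>: "MorT ?x ?y \<psi>"
      "\<And>z. word ?s z \<Longrightarrow> \<psi> (vert t0 (c @ z)) = vert t0 (d @ word_map ?s h z)"
    using \<Gamma>_to_Mor[OF t0 w(2,3,4) h(1)] by blast
  have key: "\<exists>p'\<in>L ?s. f (bdry_of (conc a p)) = bdry_of (conc c p') \<and> f (bdry_of (conc b (k p))) = bdry_of (conc d (l p'))"
    if p: "p \<in> L ?t" for p
  proof -
    obtain p' where p': "p' \<in> L ?s" "conjugate f (conc a p) = conc c p'" "conjugate f (conc b (k p)) = conc d (l p')"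
      using w(7)[OF p] by blast
    have "conc a p \<in> L t0" "conc b (k p) \<in> L t0" using p a b w(1) \<Gamma>_L[OF t w(5) p] by simp_all
    then have "f (bdry_of (conc a p)) \<in> bdry T" "f (bdry_of (conc b (k p))) \<in> bdry T" using f bdry_of_bdry by blast+
    then show ?thesis using p' bdry_of_conjugate by metis
  qed
  have "f ` cyl T ?v \<subseteq> cyl T ?x"
    unfolding cyl_vert[OF a] cyl_vert[OF w(2)] using key by blast
  moreover have "f ` cyl T ?w \<subseteq> cyl T ?y"
  proof -
    have "f (bdry_of (conc b q)) \<in> bdry_of ` conc d ` L (dl t0 d)" if "q \<in> L (dl t0 b)" for q
    proof -
      have "q \<in> k ` L ?t" using that w(1) \<Gamma>_surj[OF t w(5)] by simp
      then obtain p where p: "p \<in> L ?t" "q = k p" by blast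
      obtain p' where "p' \<in> L ?s" "f (bdry_of (conc b q)) = bdry_of (conc d (l p'))" using key[OF p(1)] p(2) by blast
      then show ?thesis using \<Gamma>_L[OF s w(6)] w(4) by simp
    qed
    then show ?thesis unfolding cyl_vert[OF b] cyl_vert[OF w(3)] by blast
  qed
  moreover have "f (induced ?v \<phi> q) = induced ?x \<psi> (f q)" if q: "q \<in> cyl T ?v" for q
  proof -
    obtain p where p: "p \<in> L ?t" "q = bdry_of (conc a p)" using q cyl_vert[OF a] by blast
    obtain p' where p': "p' \<in> L ?s" "f q = bdry_of (conc c p')" "f (bdry_of (conc b (k p))) = bdry_of (conc d (l p'))"
      using key[OF p(1)] p(2) by blast
    have "induced ?v \<phi> q = bdry_of (conc b (k p))"
      unfolding p(2) g(2) by (rule induced_bdry_of[OF a b w(1) g(1) \<phi>(2) p(1)])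
    moreover have "induced ?x \<psi> (f q) = bdry_of (conc d (l p'))"
      unfolding p'(2) h(2) by (rule induced_bdry_of[OF w(2,3,4) h(1) \<psi>(2) p'(1)])
    ultimately show ?thesis using p'(3) by simp
  qed
  ultimately show "equiv_restr T tp Mor f ?v ?w"
    unfolding equiv_restr_def using \<phi>(1) \<psi>(1) unfolding MorT_def by blast
qed

lemma word_equiv_refl:
  assumes "word t0 a" "\<And>p. p \<in> L t0 \<Longrightarrow> F p \<in> L t0"
  shows "word_equiv F a a"
proof -
  have t: "dl t0 a \<in> tp ` T" by (rule dl_closed[OF t0 assms(1)])
  obtain k where k: "k \<in> \<Gamma> (dl t0 a)" "\<forall>p\<in>L (dl t0 a). k p = p" using \<Gamma>_id[OF t] by blast
  obtain l where l: "l \<in> \<Gamma> t0" "\<forall>p\<in>L t0. l p = p" using \<Gamma>_id[OF t0] by blast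
  have FL: "F (conc a p) \<in> L t0" if "p \<in> L (dl t0 a)" for p using that assms by simp
  have "\<forall>p\<in>L (dl t0 a). \<exists>p'\<in>L t0. F (conc a p) = conc [] p' \<and> F (conc a (k p)) = conc [] (l p')"
    using k(2) l(2) FL by simp
  then show ?thesis unfolding word_equiv_def using k(1) l(1)
    by (intro conjI refl exI[of _ "[]"]) auto
qed

text \<open>Solving the equivalence for F at b, with q = k p, expresses its local action through a,
  k, l and the length of c alone. That length is bounded if the cone of a has two points, because c
  is a common prefix of their images.\<close>

lemma loc_fin_of_finite_word_equiv:
  assumes F: "homeomorphism (L t0) (L t0) F G" and V: "finite V" "\<And>a. a \<in> V \<Longrightarrow> word t0 a"
    and rep: "\<And>b. word t0 b \<Longrightarrow> \<exists>a\<in>V. word_equiv F a b"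
  shows "loc_fin t0 F"
proof -
  obtain S0 where S0: "finite S0"
    "\<And>v. word t0 v \<Longrightarrow> single (dl t0 v) \<Longrightarrow> \<exists>x. \<exists>h\<in>S0. \<forall>p\<in>L (dl t0 v). F (conc v p) = conc x (h p)"
    using loc_fin_single[OF t0 F] by blast
  have GF: "G (F p) = p" if "p \<in> L t0" for p using F that by (simp add: homeomorphism_def)
  define D where "D a m \<longleftrightarrow> (single (dl t0 a) \<or>
      (\<exists>p\<in>L (dl t0 a). \<exists>p'\<in>L (dl t0 a). pre (F (conc a p)) m \<noteq> pre (F (conc a p')) m))" for a m
  obtain N where N: "\<And>a. a \<in> V \<Longrightarrow> D a N"
  proof (rule finite_uniform_bound[OF V(1), of D])
    show "\<exists>m. D a m" if a: "a \<in> V" for a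
    proof (cases "single (dl t0 a)")
      case True then show ?thesis by (simp add: D_def)
    next
      case False
      obtain p p' where p: "p \<in> L (dl t0 a)" "p' \<in> L (dl t0 a)" "p \<noteq> p'"
        using not_singleE[OF dl_closed[OF t0 V(2)[OF a]] False] .
      then have "conc a p \<in> L t0" "conc a p' \<in> L t0" using V(2)[OF a] by simp_all
      then have "F (conc a p) \<noteq> F (conc a p')" using p(3) GF by (metis conc_inject)
      then obtain m where "pre (F (conc a p)) m \<noteq> pre (F (conc a p')) m" using ext_pre by metis
      then show ?thesis unfolding D_def using p(1,2) by blast
    qed
    show "D a n" if "D a m" "m \<le> n" for a m n
      using that unfolding D_def by (meson pre_eq_mono)
  qed blast
  define \<Delta> where "\<Delta> = (\<Union>s\<in>tp ` T. \<Gamma> s)"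
  define S where "S = (\<lambda>(a, k, l, n). \<lambda>q. l (sdrop n (F (conc a (inv_into (L (dl t0 a)) k q)))))
      ` (V \<times> \<Delta> \<times> \<Delta> \<times> {..N})"
  have "finite \<Delta>" unfolding \<Delta>_def by (rule finite_UN_I[OF finite_types finite_\<Gamma>])
  then have "finite (S0 \<union> S)" unfolding S_def using S0(1) V(1) by simp
  moreover have "\<exists>x. \<exists>h\<in>S0 \<union> S. \<forall>q\<in>L (dl t0 b). F (conc b q) = conc x (h q)" if b: "word t0 b" for b
  proof (cases "single (dl t0 b)")
    case True then show ?thesis using S0(2)[OF b] by blast
  next
    case False
    obtain a where a: "a \<in> V" "word_equiv F a b" using rep[OF b] by blast
    let ?t = "dl t0 a"
    have t: "?t \<in> tp ` T" by (rule dl_closed[OF t0 V(2)[OF a(1)]])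
    obtain c e k l where w: "?t = dl t0 b" "word t0 c" "word t0 e" "dl t0 c = dl t0 e"
      "k \<in> \<Gamma> ?t" "l \<in> \<Gamma> (dl t0 c)"
      "\<And>p. p \<in> L ?t \<Longrightarrow> \<exists>p'\<in>L (dl t0 c). F (conc a p) = conc c p' \<and> F (conc b (k p)) = conc e (l p')"
      using a(2) unfolding word_equiv_def by blast
    have s: "dl t0 c \<in> tp ` T" by (rule dl_closed[OF t0 w(2)])
    have "length c \<le> N"
    proof (rule ccontr)
      assume n: "\<not> length c \<le> N"
      have "pre (F (conc a p)) N = take N c" if "p \<in> L ?t" for p
        using w(7)[OF that] n pre_conc_le[of N c] by fastforce
      then show False using N[OF a(1)] False w(1) unfolding D_def by metis
    qed
    then have mem: "(\<lambda>q. l (sdrop (length c) (F (conc a (inv_into (L ?t) k q))))) \<in> S0 \<union> S"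
      unfolding S_def \<Delta>_def using a(1) w(5,6) t s
      by (intro UnI2 image_eqI[of _ _ "(a, k, l, length c)"]) auto
    have eq: "F (conc b q) = conc e (l (sdrop (length c) (F (conc a (inv_into (L ?t) k q)))))"
      if q: "q \<in> L (dl t0 b)" for q
    proof -
      have q': "q \<in> k ` L ?t" using q w(1) \<Gamma>_surj[OF t w(5)] by simp
      let ?p = "inv_into (L ?t) k q"
      have p: "?p \<in> L ?t" "k ?p = q" using inv_into_into[OF q'] f_inv_into_f[OF q'] by blast+
      obtain p' where p': "F (conc a ?p) = conc c p'" "F (conc b q) = conc e (l p')"
        using w(7)[OF p(1)] p(2) by auto
      then show ?thesis by simp
    qed
    show ?thesis by (intro exI[of _ e] bexI[OF _ mem] ballI) (rule eq)
  qed
  ultimately show ?thesis unfolding loc_fin_def by blast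
qed

text \<open>This compares image sets of the relation directly. The prefixes c and c' start the same
  word, so one extends the other: if c' = c @ z, use d @ z in its place; if c = c' @ z, move z
  through the twist l by \<open>\<Gamma>_restrict\<close>.\<close>

lemma word_equiv_transfer:
  assumes a: "word t0 a" and b: "word t0 b" and ab: "dl t0 a = dl t0 b"
    and c: "word t0 c" and d: "word t0 d" and cd: "dl t0 c = dl t0 d"
    and h: "\<And>p. p \<in> L (dl t0 a) \<Longrightarrow> F (conc a p) = conc c (h p) \<and> F (conc b p) = conc d (h p)"
    and hL: "\<And>p. p \<in> L (dl t0 a) \<Longrightarrow> h p \<in> L (dl t0 c)"
    and u: "word_equiv F a u"
  shows "word_equiv F b u"
proof -
  let ?t = "dl t0 a"
  obtain c' e k l where w: "?t = dl t0 u" "word t0 c'" "word t0 e" "dl t0 c' = dl t0 e"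
    "k \<in> \<Gamma> ?t" "l \<in> \<Gamma> (dl t0 c')"
    "\<And>p. p \<in> L ?t \<Longrightarrow> \<exists>p'\<in>L (dl t0 c'). F (conc a p) = conc c' p' \<and> F (conc u (k p)) = conc e (l p')"
    using u unfolding word_equiv_def by blast
  obtain p0 where p0: "p0 \<in> L ?t" using L_nonempty[OF dl_closed[OF t0 a]] by blast
  obtain p0' where p0': "conc c (h p0) = conc c' p0'" using w(7)[OF p0] h[OF p0] by auto
  show ?thesis
  proof (cases "length c \<le> length c'")
    case True
    obtain z where z: "c' = c @ z" using conc_eqD[OF p0' True] by blast
    have dz: "word t0 (d @ z)" "dl t0 (d @ z) = dl t0 c'" using w(2) z d cd by simp_all
    have "\<exists>p'\<in>L (dl t0 (d @ z)). F (conc b p) = conc (d @ z) p' \<and> F (conc u (k p)) = conc e (l p')"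
      if p: "p \<in> L ?t" for p
    proof -
      obtain p' where p': "p' \<in> L (dl t0 c')" "F (conc a p) = conc c' p'" "F (conc u (k p)) = conc e (l p')"
        using w(7)[OF p] by blast
      have "conc c (h p) = conc c (conc z p')" using p'(2) h[OF p] z by (simp add: conc_append)
      then have "F (conc b p) = conc (d @ z) p'" using h[OF p] by (simp add: conc_append)
      then show ?thesis using p' dz(2) by metis
    qed
    then have "\<forall>p\<in>L (dl t0 b). \<exists>p'\<in>L (dl t0 (d @ z)). F (conc b p) = conc (d @ z) p' \<and> F (conc u (k p)) = conc e (l p')"
      unfolding ab by blast
    moreover have "k \<in> \<Gamma> (dl t0 b)" "l \<in> \<Gamma> (dl t0 (d @ z))" using w(5,6) ab dz(2) by metis+
    moreover have "dl t0 b = dl t0 u" "dl t0 (d @ z) = dl t0 e" using ab w(1,4) dz(2) by metis+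
    ultimately show ?thesis unfolding word_equiv_def using dz(1) w(3) by blast
  next
    case False
    then have le: "length c' \<le> length c" by simp
    obtain z where z: "c = c' @ z" using conc_eqD[OF p0'[symmetric] le] by blast
    have wz: "word (dl t0 c') z" using c z by simp
    have s: "dl t0 c' \<in> tp ` T" by (rule dl_closed[OF t0 w(2)])
    obtain z' l' where l': "word (dl t0 c') z'" "dl (dl t0 c') z' = dl (dl t0 c') z"
      "l' \<in> \<Gamma> (dl (dl t0 c') z)" "\<And>p. p \<in> L (dl (dl t0 c') z) \<Longrightarrow> l (conc z p) = conc z' (l' p)"
      using \<Gamma>_restrict[OF s w(6) wz] by blast
    have cz: "dl (dl t0 c') z = dl t0 d" using cd z by simp
    have e: "word t0 (e @ z')" "dl t0 (e @ z') = dl t0 d" using w(3,4) l'(1,2) cz by simp_all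
    have "\<exists>p'\<in>L (dl t0 d). F (conc b p) = conc d p' \<and> F (conc u (k p)) = conc (e @ z') (l' p')"
      if p: "p \<in> L ?t" for p
    proof -
      obtain p' where p': "F (conc a p) = conc c' p'" "F (conc u (k p)) = conc e (l p')"
        using w(7)[OF p] by blast
      have "conc c' (conc z (h p)) = conc c' p'" using p'(1) h[OF p] z by (simp add: conc_append)
      then have "p' = conc z (h p)" by simp
      moreover have hd: "h p \<in> L (dl t0 d)" using hL[OF p] cd by simp
      ultimately have "F (conc u (k p)) = conc (e @ z') (l' (h p))"
        using p'(2) l'(4)[of "h p"] cz by (simp add: conc_append)
      then show ?thesis using h[OF p] hd by blast
    qed
    then have "\<forall>p\<in>L (dl t0 b). \<exists>p'\<in>L (dl t0 d). F (conc b p) = conc d p' \<and> F (conc u (k p)) = conc (e @ z') (l' p')"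
      unfolding ab by blast
    moreover have "k \<in> \<Gamma> (dl t0 b)" "l' \<in> \<Gamma> (dl t0 d)" using w(5) l'(3) ab cz by simp_all
    moreover have "dl t0 b = dl t0 u" "dl t0 d = dl t0 (e @ z')" using ab w(1) e(2) by simp_all
    ultimately show ?thesis unfolding word_equiv_def using d e(1) by blast
  qed
qed

lemma rational_iff_loc_fin:
  assumes fg: "homeomorphism (bdry T) (bdry T) f g"
  shows "rational T tp Mor f \<longleftrightarrow> loc_fin t0 (conjugate f)"
proof -
  define R where "R = {(v, w). equiv_restr T tp Mor f v w}"
  have f: "f ` bdry T \<subseteq> bdry T" using fg by (simp add: homeomorphism_def)
  have FG: "homeomorphism (L t0) (L t0) (conjugate f) (conjugate g)" by (rule homeomorphism_conjugate[OF fg])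
  have FL: "conjugate f p \<in> L t0" if "p \<in> L t0" for p using FG that by (auto simp: homeomorphism_def)
  have R_iff: "(vert t0 a, vert t0 b) \<in> R \<longleftrightarrow> word_equiv (conjugate f) a b" if "word t0 a" "word t0 b" for a b
    unfolding R_def using equiv_restr_word_equiv[OF f that] by simp
  have RT: "w \<in> T" if "(v, w) \<in> R" for v w using that by (simp add: R_def equiv_restr_def)
  define addr where "addr v = (SOME a. word t0 a \<and> vert t0 a = v)" for v
  have addr: "word t0 (addr v)" "vert t0 (addr v) = v" if "v \<in> T" for v
    using someI_ex[OF vert0_surj[OF that]] unfolding addr_def by blast+
  show ?thesis
  proof
    assume "rational T tp Mor f"
    then have fin: "finite (T // R)" by (simp add: rational_def R_def)
    define pick where "pick X = (SOME v. v \<in> T \<and> X = R `` {v})" for X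
    have pick: "pick X \<in> T \<and> X = R `` {pick X}" if X: "X \<in> T // R" for X
    proof -
      obtain v where "v \<in> T \<and> X = R `` {v}" using X unfolding quotient_def by blast
      then show ?thesis unfolding pick_def by (rule someI)
    qed
    let ?V = "(\<lambda>X. addr (pick X)) ` (T // R)"
    have "finite ?V" using fin by simp
    moreover have "word t0 a" if "a \<in> ?V" for a using that pick addr by blast
    moreover have "\<exists>a\<in>?V. word_equiv (conjugate f) a b" if b: "word t0 b" for b
    proof -
      let ?X = "R `` {vert t0 b}"
      have X: "?X \<in> T // R" using vert_T[OF b] by (rule quotientI)
      \<comment> \<open>Reflexivity puts the vertex into its own class, so the vertex picked for
        that class is related to it in the order needed here.\<close>
      have "vert t0 b \<in> ?X" using R_iff[OF b b] word_equiv_refl[OF b FL] by simp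
      then have "(pick ?X, vert t0 b) \<in> R" using pick[OF X] by blast
      then have "(vert t0 (addr (pick ?X)), vert t0 b) \<in> R" using addr pick[OF X] by simp
      then have "word_equiv (conjugate f) (addr (pick ?X)) b" using R_iff[OF _ b] addr pick[OF X] by blast
      then show ?thesis using X by blast
    qed
    ultimately show "loc_fin t0 (conjugate f)" by (rule loc_fin_of_finite_word_equiv[OF FG])
  next
    assume "loc_fin t0 (conjugate f)"
    then obtain S where S: "finite S"
      "\<And>v. word t0 v \<Longrightarrow> \<exists>x. \<exists>h\<in>S. \<forall>p\<in>L (dl t0 v). conjugate f (conc v p) = conc x (h p)"
      unfolding loc_fin_def by blast
    then obtain x h where xh: "\<And>v. word t0 v \<Longrightarrow> h v \<in> S"
      "\<And>v p. word t0 v \<Longrightarrow> p \<in> L (dl t0 v) \<Longrightarrow> conjugate f (conc v p) = conc (x v) (h v p)"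
      by metis
    have xL: "conc (x v) (h v p) \<in> L t0" if v: "word t0 v" "p \<in> L (dl t0 v)" for v p
      using FL[of "conc v p"] xh(2)[OF v] v by simp
    have wx: "word t0 (x v)" if v: "word t0 v" for v
      using xL[OF v] L_nonempty[OF dl_closed[OF t0 v]] by auto
    \<comment> \<open>Source state, local map and target state are the data that
      \<open>word_equiv_transfer\<close> compares. They determine the image of v under R and take
      finitely many values.\<close>
    define J where "J v = (dl t0 (addr v), h (addr v), dl t0 (x (addr v)))" for v
    have "J ` T \<subseteq> tp ` T \<times> S \<times> tp ` T"
      unfolding J_def using addr(1) xh(1) wx dl_closed[OF t0] by auto
    then have finJ: "finite (J ` T)" using S(1) finite_types by (meson finite_SigmaI finite_subset)
    have sub: "R `` {v} \<subseteq> R `` {w}" if v: "v \<in> T" and w: "w \<in> T" and J: "J v = J w" for v w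
    proof
      fix u assume "u \<in> R `` {v}"
      then have vu: "(v, u) \<in> R" by blast
      let ?a = "addr v" let ?b = "addr w" let ?u = "addr u"
      have uT: "u \<in> T" by (rule RT[OF vu])
      have wa: "word t0 ?a" "word t0 ?b" "word t0 ?u" using addr v w uT by blast+
      have JJ: "dl t0 ?a = dl t0 ?b" "h ?a = h ?b" "dl t0 (x ?a) = dl t0 (x ?b)" using J by (simp_all add: J_def)
      have "word_equiv (conjugate f) ?a ?u" using R_iff[OF wa(1,3)] vu addr v uT by simp
      then have "word_equiv (conjugate f) ?b ?u"
      proof (rule word_equiv_transfer[OF wa(1,2) JJ(1) wx[OF wa(1)] wx[OF wa(2)] JJ(3), rotated 2])
        show "conjugate f (conc ?a p) = conc (x ?a) (h ?a p) \<and> conjugate f (conc ?b p) = conc (x ?b) (h ?a p)"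
          if "p \<in> L (dl t0 ?a)" for p
          using xh(2)[OF wa(1) that] xh(2)[OF wa(2)] that JJ by simp
        show "h ?a p \<in> L (dl t0 (x ?a))" if "p \<in> L (dl t0 ?a)" for p
          using xL[OF wa(1) that] by simp
      qed
      then have "(w, u) \<in> R" using R_iff[OF wa(2,3)] addr w uT by simp
      then show "u \<in> R `` {w}" by blast
    qed
    have "T // R \<subseteq> (\<lambda>j. R `` {SOME v. v \<in> T \<and> J v = j}) ` (J ` T)"
    proof
      fix X assume "X \<in> T // R"
      then obtain v where v: "v \<in> T" "X = R `` {v}" by (auto simp: quotient_def)
      let ?w = "SOME w. w \<in> T \<and> J w = J v"
      have "?w \<in> T \<and> J ?w = J v" by (rule someI[of _ v]) (simp add: v(1))
      then have "X = R `` {?w}" using sub v by (metis subset_antisym)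
      then show "X \<in> (\<lambda>j. R `` {SOME v. v \<in> T \<and> J v = j}) ` (J ` T)" using v(1) by blast
    qed
    then have "finite (T // R)" using finJ by (meson finite_imageI finite_subset)
    then show "rational T tp Mor f" by (simp add: rational_def R_def)
  qed
qed

section \<open>The group of rational homeomorphisms and its action\<close>

lemma RT_set_iff:
  "f \<in> RT_set T tp Mor \<longleftrightarrow> f \<in> extensional (bdry T) \<and>
     (\<exists>g. homeomorphism (bdry T) (bdry T) f g) \<and> loc_fin t0 (conjugate f)"
  unfolding RT_set_def using rational_iff_loc_fin by blast

lemma conjugate_compose:
  assumes "homeomorphism (bdry T) (bdry T) g g'" "p \<in> L t0"
  shows "conjugate (compose (bdry T) f g) p = conjugate f (conjugate g p)"
proof -
  have "g (bdry_of p) \<in> bdry T" using assms bdry_of_bdry by (auto simp: homeomorphism_def)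
  then show ?thesis using bdry_of_bdry[OF assms(2)] by (simp add: conjugate_def compose_def)
qed

lemma homeomorphism_restrict:
  assumes "homeomorphism X X f g"
  shows "homeomorphism X X (restrict f X) (restrict g X)"
  using assms by (rule homeomorphism_cong) auto

lemma RT_compose:
  assumes f: "f \<in> RT_set T tp Mor" and g: "g \<in> RT_set T tp Mor"
  shows "compose (bdry T) f g \<in> RT_set T tp Mor"
proof -
  obtain f' g' where h: "homeomorphism (bdry T) (bdry T) f f'" "homeomorphism (bdry T) (bdry T) g g'"
    using f g unfolding RT_set_iff by blast
  have gL: "conjugate g ` L t0 \<subseteq> L t0" using homeomorphism_conjugate[OF h(2)] by (simp add: homeomorphism_def)
  have "homeomorphism (bdry T) (bdry T) (restrict (f \<circ> g) (bdry T)) (restrict (g' \<circ> f') (bdry T))"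
    by (rule homeomorphism_restrict[OF homeomorphism_compose[OF h(2,1)]])
  moreover have "restrict (f \<circ> g) (bdry T) = compose (bdry T) f g" by (simp add: compose_def comp_def)
  moreover have "loc_fin t0 (conjugate (compose (bdry T) f g))"
    using loc_fin_compose[OF t0 _ _ gL] f g loc_fin_cong[of t0 "conjugate (compose (bdry T) f g)" "\<lambda>p. conjugate f (conjugate g p)"]
      conjugate_compose[OF h(2)] unfolding RT_set_iff by blast
  ultimately show ?thesis unfolding RT_set_iff by (metis compose_extensional)
qed

lemma RT_one: "restrict (\<lambda>p. p) (bdry T) \<in> RT_set T tp Mor"
proof -
  have "homeomorphism (bdry T) (bdry T) (restrict (\<lambda>p. p) (bdry T)) (restrict (\<lambda>p. p) (bdry T))"
    by (rule homeomorphism_restrict) (rule homeomorphism_ident)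
  moreover have "loc_fin t0 (conjugate (restrict (\<lambda>p. p) (bdry T)))"
    using loc_fin_id[of t0] loc_fin_cong[of t0 "conjugate (restrict (\<lambda>p. p) (bdry T))" "\<lambda>p. p"] bdry_of_bdry
    by (simp add: conjugate_def)
  ultimately show ?thesis unfolding RT_set_iff by auto
qed

lemma RT_inverse:
  assumes f: "f \<in> RT_set T tp Mor"
  shows "\<exists>g\<in>RT_set T tp Mor. compose (bdry T) g f = restrict (\<lambda>p. p) (bdry T)"
proof -
  obtain g where fg: "homeomorphism (bdry T) (bdry T) f g" using f unfolding RT_set_iff by blast
  let ?g = "restrict g (bdry T)"
  have gf: "homeomorphism (bdry T) (bdry T) ?g (restrict f (bdry T))"
    by (rule homeomorphism_restrict[OF homeomorphism_symD[OF fg]])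
  have "loc_fin t0 (conjugate g)"
    using loc_fin_inverse[OF t0 homeomorphism_conjugate[OF fg]] f unfolding RT_set_iff by blast
  moreover have "conjugate ?g p = conjugate g p" if "p \<in> L t0" for p using bdry_of_bdry[OF that] by (simp add: conjugate_def)
  ultimately have "loc_fin t0 (conjugate ?g)" using loc_fin_cong by metis
  then have "?g \<in> RT_set T tp Mor" unfolding RT_set_iff using gf by auto
  moreover have "compose (bdry T) ?g f = restrict (\<lambda>p. p) (bdry T)"
    using fg by (auto simp: compose_def homeomorphism_def intro!: restrict_ext)
  ultimately show ?thesis by blast
qed

lemma compose_maps:
  assumes "f \<in> RT_set T tp Mor" "p \<in> bdry T" shows "f p \<in> bdry T"
proof -
  have "f ` bdry T = bdry T" using assms(1) by (auto simp: RT_set_def homeomorphism_def)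
  then show ?thesis using assms(2) by blast
qed

lemma group_RT: "group (RT_group T tp Mor)"
proof (rule groupI)
  let ?G = "RT_group T tp Mor"
  show "f \<otimes>\<^bsub>?G\<^esub> g \<in> carrier ?G" if "f \<in> carrier ?G" "g \<in> carrier ?G" for f g
    using that RT_compose by (simp add: RT_group_def)
  show "\<one>\<^bsub>?G\<^esub> \<in> carrier ?G" using RT_one by (simp add: RT_group_def)
  show "f \<otimes>\<^bsub>?G\<^esub> g \<otimes>\<^bsub>?G\<^esub> h = f \<otimes>\<^bsub>?G\<^esub> (g \<otimes>\<^bsub>?G\<^esub> h)"
    if "f \<in> carrier ?G" "g \<in> carrier ?G" "h \<in> carrier ?G" for f g h
    using that compose_maps by (auto simp: RT_group_def compose_def intro!: restrict_ext)
  show "\<one>\<^bsub>?G\<^esub> \<otimes>\<^bsub>?G\<^esub> f = f" if "f \<in> carrier ?G" for f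
  proof
    fix p
    have "f \<in> extensional (bdry T)" using that by (simp add: RT_group_def RT_set_def)
    then show "(\<one>\<^bsub>?G\<^esub> \<otimes>\<^bsub>?G\<^esub> f) p = f p"
      using that compose_maps by (auto simp: RT_group_def compose_def extensional_def)
  qed
  show "\<exists>g\<in>carrier ?G. g \<otimes>\<^bsub>?G\<^esub> f = \<one>\<^bsub>?G\<^esub>" if "f \<in> carrier ?G" for f
    using that RT_inverse by (simp add: RT_group_def)
qed

text \<open>Here q decodes a binary word and passes to the boundary, and \<Phi> is the lift.
  Injectivity is formal: q is onto, so equivariance recovers f on \<open>bdry T\<close>, and f is
  extensional.\<close>

lemma rational_action:
  "\<exists>(q :: (nat \<Rightarrow> bool) \<Rightarrow> (nat \<Rightarrow> nat)) \<Phi>.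
       continuous_on UNIV q \<and> q ` UNIV = bdry T \<and>
       \<Phi> \<in> hom (RT_group T tp Mor) R2_group \<and>
       inj_on \<Phi> (carrier (RT_group T tp Mor)) \<and>
       (\<forall>f\<in>carrier (RT_group T tp Mor). \<forall>x. q (\<Phi> f x) = f (q x))"
proof -
  define q where "q x = bdry_of (E t0 x)" for x
  define \<Phi> where "\<Phi> f = lift t0 (conjugate f)" for f
  have carr: "carrier (RT_group T tp Mor) = RT_set T tp Mor" by (simp add: RT_group_def)
  have contq: "continuous_on UNIV q"
    unfolding q_def by (rule continuous_on_compose2[OF continuous_on_bdry_of continuous_on_E[OF t0]])
      (use E_L[OF t0] in auto)
  have "range q = bdry_of ` range (E t0)" unfolding q_def by (simp only: image_image)
  then have surjq: "range q = bdry T" by (simp only: E_image[OF t0] bdry_of_image)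
  have equi: "q (\<Phi> f x) = f (q x)" if f: "f \<in> RT_set T tp Mor" for f x
  proof -
    obtain g where fg: "homeomorphism (bdry T) (bdry T) f g" using f unfolding RT_set_iff by blast
    have "q (\<Phi> f x) = bdry_of (conjugate f (E t0 x))"
      unfolding q_def \<Phi>_def using lift_spec[OF t0 homeomorphism_conjugate[OF fg]] by simp
    also have "\<dots> = f (q x)"
      unfolding q_def using bdry_of_conjugate compose_maps[OF f bdry_of_bdry[OF E_L[OF t0]]] by blast
    finally show ?thesis .
  qed
  have inj: "inj_on \<Phi> (RT_set T tp Mor)"
  proof (rule inj_onI)
    fix f g assume fg: "f \<in> RT_set T tp Mor" "g \<in> RT_set T tp Mor" "\<Phi> f = \<Phi> g"
    have ext: "f \<in> extensional (bdry T)" "g \<in> extensional (bdry T)" using fg by (simp_all add: RT_set_def)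
    have "f p = g p" if p: "p \<in> bdry T" for p
    proof -
      obtain x where "p = q x" using surjq p by blast
      then show ?thesis using equi fg by metis
    qed
    then show "f = g" by (rule extensionalityI[OF ext])
  qed
  have "\<Phi> (compose (bdry T) f g) = \<Phi> f \<circ> \<Phi> g" if fg: "f \<in> RT_set T tp Mor" "g \<in> RT_set T tp Mor" for f g
  proof -
    obtain f' g' where h: "homeomorphism (bdry T) (bdry T) f f'" "homeomorphism (bdry T) (bdry T) g g'"
      using fg unfolding RT_set_iff by blast
    have "\<Phi> (compose (bdry T) f g) = lift t0 (\<lambda>p. conjugate f (conjugate g p))"
      unfolding \<Phi>_def by (rule lift_cong[OF t0 conjugate_compose[OF h(2)]])
    then show ?thesis
      unfolding \<Phi>_def using lift_compose[OF t0 homeomorphism_conjugate[OF h(1)] homeomorphism_conjugate[OF h(2)]] by simp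
  qed
  moreover have "\<Phi> f \<in> R2_set" if "f \<in> RT_set T tp Mor" for f
    using that lift_R2[OF t0 homeomorphism_conjugate] unfolding \<Phi>_def RT_set_iff by blast
  ultimately have "\<Phi> \<in> hom (RT_group T tp Mor) R2_group"
    unfolding hom_def by (simp add: RT_group_def R2_group_def)
  then show ?thesis using contq surjq inj equi unfolding carr by blast
qed

end

theorem mainTheorem9:
  fixes T :: "nat list set" and tp :: "nat list \<Rightarrow> 'k"
    and Mor :: "nat list \<Rightarrow> nat list \<Rightarrow> (nat list \<Rightarrow> nat list) set"
  assumes "self_similar T tp Mor" and "no_dead_ends T"
  shows "group (RT_group T tp Mor) \<and>
    (\<exists>(q :: (nat \<Rightarrow> bool) \<Rightarrow> (nat \<Rightarrow> nat)) \<Phi>.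
       continuous_on UNIV q \<and> q ` UNIV = bdry T \<and>
       \<Phi> \<in> hom (RT_group T tp Mor) R2_group \<and>
       inj_on \<Phi> (carrier (RT_group T tp Mor)) \<and>
       (\<forall>f\<in>carrier (RT_group T tp Mor). \<forall>x. q (\<Phi> f x) = f (q x)))"
proof -
  interpret self_similar_tree T tp Mor
    using assms by (rule self_similar_tree.intro)
  show ?thesis using group_RT rational_action by blast
qed

end
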